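(* Let $0<\xi<1$, $n=\xi N$, and let $A_1$ and $A_2$ be the independent random $n\times N$ sign matrices constructed as in the context ($A_1$ has $k$-wise independent entries with $k=\Theta(\log n)$, $k\ge C_1\log n$ for a numerical constant $C_1>0$; the rows of $A_2$ come from a random walk on an expander graph). Let $A=A_1\bullet A_2$ and $E=\operatorname{Ker}A=\{x\in\mathbb{R}^N : Ax=0\}$. Then, with probability $1-o(1)$, $$\frac{c'\,\xi}{\sqrt{\log 1/\xi}}\,\sqrt{N}\,\|x\|_2\le\|x\|_1\le\sqrt{N}\,\|x\|_2\qquad\text{for every }x\in E,$$ where $c'>0$ is a universal constant.
   Context: For $p\ge1$ and $x\in\mathbb{R}^N$, $\|x\|_p=\left(\sum_{i}|x_i|^p\right)^{1/p}$. The notation $o(1)$ denotes a quantity tending to $0$ as $N\to\infty$, and $f=\Theta(g)$ means that $f$ and $g$ are bounded by constant multiples of each other for large arguments. A sign matrix is a matrix with all entries $\pm1$. The Hadamard product $A_1\bullet A_2$ of two matrices of the same size is the entrywise product: $(A_1\bullet A_2)_{i,j}=(A_1)_{i,j}(A_2)_{i,j}$. Random variables $X_1,\dots,X_M$ are $k$-wise independent random signs if each $X_m$ takes the values $-1$ and $1$ with probability $1/2$ each, and every $k$ of them are independent. For $k\le M$, $\Upsilon_{k,M}\subset\{-1,1\}^M$ denotes a fixed set of cardinality $2^{C_{k,M}}$ with $C_{k,M}=O(k\log M)$, such that the coordinates of a uniformly chosen element of $\Upsilon_{k,M}$ are $k$-wise independent random signs, and which is explicit: there is a bijection $\{-1,1\}^{C_{k,M}}\to\Upsilon_{k,M}$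 computable in time polynomial in $k$ and $M$. Construction of $A_1$: regarded as a vector in $\{-1,1\}^{nN}$, it is a uniformly chosen element of $\Upsilon_{k,nN}$. Construction of $A_2$: let $G=(\mathcal V,\mathcal E)$ be a $d$-regular graph ($d\ge3$ a constant, e.g. $d=4$) whose vertices are indexed by the elements of $\Upsilon_{4,N}$. Let $P^G$ be the transition matrix of the random walk on $G$ ($P^G_{uv}=1/d$ if $(u,v)\in\mathcal E$, and $0$ otherwise), with eigenvalues $1=\lambda_1\ge\lambda_2\ge\cdots$, and put $\lambda=\max_{i\ge2}|\lambda_i|$. The graph $G$ is an expander with $\lambda<0.95$ and is explicit (the set of neighbours of any vertex can be computed in time polynomial in $\log|\mathcal V|$). Let $v_1,\dots,v_n$ be a random walk on $G$ starting from a uniformly random vertex. The $i$-th row of $A_2$ is the sign vector in $\Upsilon_{4,N}$ corresponding to $v_i$. The matrices $A_1$ and $A_2$ are independent of each other.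
   Formalization: log 1/ξ is replaced by max(1, log 1/ξ): as ξ → 1 the printed lower constant exceeds 1 for any universal c', which is impossible since Ker A ≠ 0 and ‖x‖₁ ≤ √N‖x‖₂. Also n is taken as the integer part of ξN. *)

theory Defs
  imports
    "HOL-Probability.Probability"
    "HOL-Library.Landau_Symbols"
    "Graph_Theory.Pair_Digraph"
    "Jordan_Normal_Form.Matrix_Kernel"
    "Jordan_Normal_Form.Char_Poly"
begin

unbundle no vec_syntax

section \<open>Vectors and matrices\<close>

definition lp_norm :: "real \<Rightarrow> real vec \<Rightarrow> real" where
  "lp_norm p x = (\<Sum>i<dim_vec x. \<bar>x $ i\<bar> powr p) powr (1 / p)"

definition sign_vecs :: "nat \<Rightarrow> real vec set" where
  "sign_vecs M = {v \<in> carrier_vec M. \<forall>i<M. v $ i = 1 \<or> v $ i = - 1}"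

definition hadamard_prod :: "real mat \<Rightarrow> real mat \<Rightarrow> real mat" (infixl "\<bullet>\<^sub>H" 70) where
  "A \<bullet>\<^sub>H B = mat (dim_row A) (dim_col A) (\<lambda>(i, j). A $$ (i, j) * B $$ (i, j))"

section \<open>Random signs with limited independence\<close>

definition kwise_random_signs :: "'a measure \<Rightarrow> nat \<Rightarrow> nat \<Rightarrow> (nat \<Rightarrow> 'a \<Rightarrow> real) \<Rightarrow> bool" where
  "kwise_random_signs P k M X \<longleftrightarrow>
     (\<forall>m<M. measure P {\<omega> \<in> space P. X m \<omega> = 1} = 1 / 2 \<and>
            measure P {\<omega> \<in> space P. X m \<omega> = - 1} = 1 / 2) \<and>
     (\<forall>I. I \<subseteq> {..<M} \<and> card I = k \<longrightarrow> prob_space.indep_vars P (\<lambda>_. borel) X I)"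

section \<open>Polynomial-time computability\<close>

text \<open>
  Deterministic Turing machines with one two-sided infinite tape, states and tape symbols
  being initial segments of the naturals. State 0 is the (absorbing) halting state, state 1
  the initial state, symbol 0 the blank. A transition gives the new state, the symbol
  written, and the head movement. Input and output start at cell 0; on halting every cell
  outside the output has to be blank, while the position of the head is irrelevant.
\<close>

type_synonym tm = "nat \<Rightarrow> nat \<Rightarrow> nat \<times> nat \<times> int"

definition turing_machine :: "tm \<Rightarrow> bool" where
  "turing_machine \<delta> \<longleftrightarrow> (\<exists>Q S. 2 \<le> Q \<and> 4 \<le> S \<and>
     (\<forall>q<Q. \<forall>a<S. case \<delta> q a of (q', b, m) \<Rightarrow> q' < Q \<and> b < S \<and> m \<in> {- 1, 0, 1}))"

type_synonym tm_config = "nat \<times> (int \<Rightarrow> nat) \<times> int"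

definition tm_step :: "tm \<Rightarrow> tm_config \<Rightarrow> tm_config" where
  "tm_step \<delta> = (\<lambda>(q, t, h). if q = 0 then (q, t, h)
     else case \<delta> q (t h) of (q', b, m) \<Rightarrow> (q', t(h := b), h + m))"

definition tape_of :: "nat list \<Rightarrow> int \<Rightarrow> nat" where
  "tape_of w i = (if 0 \<le> i \<and> nat i < length w then w ! nat i else 0)"

definition computes_within :: "tm \<Rightarrow> nat list \<Rightarrow> nat list \<Rightarrow> nat \<Rightarrow> bool" where
  "computes_within \<delta> input out T \<longleftrightarrow>
     (\<exists>h. (tm_step \<delta> ^^ T) (1, tape_of input, 0) = (0, tape_of out, h))"

text \<open>Symbols 1 and 2 encode the signs $-1$ and $1$ (or binary digits); 3 is a separator.\<close>

definition enc_signs :: "real vec \<Rightarrow> nat list" where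
  "enc_signs v = map (\<lambda>a. if a = 1 then 2 else 1) (list_of_vec v)"

definition enc_unary :: "nat \<Rightarrow> nat list" where
  "enc_unary n = replicate n 1"

fun enc_binary :: "nat \<Rightarrow> nat list" where
  "enc_binary n = (if n = 0 then [] else (1 + n mod 2) # enc_binary (n div 2))"

declare enc_binary.simps [simp del]

section \<open>The sets $\Upsilon_{k,M}$\<close>

text \<open>
  \<open>C k M\<close> is the logarithm of the cardinality of \<open>\<Upsilon> k M\<close>, and \<open>\<phi> k M\<close> is its explicit
  parametrization by a discrete cube; a single machine serves all pairs \<open>k\<close>, \<open>M\<close>.
  The bound on \<open>C k M\<close> is only required for \<open>M \<ge> 2\<close>, since \<open>ln 1 = 0\<close>.
\<close>

definition explicit_kwise_family ::
  "(nat \<Rightarrow> nat \<Rightarrow> real vec set) \<Rightarrow> (nat \<Rightarrow> nat \<Rightarrow> nat) \<Rightarrow> (nat \<Rightarrow> nat \<Rightarrow> real vec \<Rightarrow> real vec) \<Rightarrow> bool"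
where
  "explicit_kwise_family \<Upsilon> C \<phi> \<longleftrightarrow>
     (\<forall>k M. 1 \<le> k \<and> k \<le> M \<longrightarrow>
        \<Upsilon> k M \<subseteq> sign_vecs M \<and>
        card (\<Upsilon> k M) = 2 ^ C k M \<and>
        kwise_random_signs (measure_pmf (pmf_of_set (\<Upsilon> k M))) k M (\<lambda>m u. u $ m) \<and>
        bij_betw (\<phi> k M) (sign_vecs (C k M)) (\<Upsilon> k M)) \<and>
     (\<exists>K. \<forall>k M. 1 \<le> k \<and> k \<le> M \<and> 2 \<le> M \<longrightarrow> real (C k M) \<le> K * real k * ln (real M)) \<and>
     (\<exists>\<delta> a e. turing_machine \<delta> \<and>
        (\<forall>k M. 1 \<le> k \<and> k \<le> M \<longrightarrow>
          (\<forall>s \<in> sign_vecs (C k M).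
             computes_within \<delta> (enc_unary k @ [3] @ enc_unary M @ [3] @ enc_signs s)
               (enc_signs (\<phi> k M s)) (a * (k + M) ^ e))))"

section \<open>Random walks on regular graphs and expanders\<close>

definition regular_graph :: "'a pair_pre_digraph \<Rightarrow> nat \<Rightarrow> bool" where
  "regular_graph G d \<longleftrightarrow> pair_graph G \<and> (\<forall>v \<in> pverts G. card {w. (v, w) \<in> parcs G} = d)"

text \<open>The list \<open>vs\<close> fixes an ordering of the vertices, used to index rows and columns.\<close>

definition transition_matrix :: "'a pair_pre_digraph \<Rightarrow> nat \<Rightarrow> 'a list \<Rightarrow> real mat" where
  "transition_matrix G d vs = mat (length vs) (length vs)
     (\<lambda>(i, j). if (vs ! i, vs ! j) \<in> parcs G then 1 / real d else 0)"

text \<open>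
  \<open>ls\<close> lists the eigenvalues of the transition matrix in decreasing order, with multiplicity.
  The characteristic polynomial does not depend on the ordering \<open>vs\<close>, and \<open>ls\<close> exists and is
  unique because the matrix is symmetric.
\<close>

definition walk_eigenvalues :: "'a pair_pre_digraph \<Rightarrow> nat \<Rightarrow> real list \<Rightarrow> bool" where
  "walk_eigenvalues G d ls \<longleftrightarrow>
     sorted_wrt (\<ge>) ls \<and>
     (\<exists>vs. distinct vs \<and> set vs = pverts G \<and>
        char_poly (transition_matrix G d vs) = (\<Prod>l\<leftarrow>ls. [:- l, 1:]))"

definition expander_graph :: "'a pair_pre_digraph \<Rightarrow> nat \<Rightarrow> real \<Rightarrow> bool" where
  "expander_graph G d r \<longleftrightarrow> regular_graph G d \<and>
     (\<exists>ls. walk_eigenvalues G d ls \<and> (MAX i\<in>{1..<length ls}. \<bar>ls ! i\<bar>) < r)"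

text \<open>
  The graphs \<open>G N\<close> have vertex sets \<open>\<Upsilon> 4 N\<close>. For the computation a vertex is represented by its
  index in the cube of dimension \<open>C 4 N\<close>, which is the binary logarithm of the number of
  vertices; the list \<open>ss\<close> enumerates the indices of the neighbours of the vertex of index \<open>s\<close>.
\<close>

definition explicit_expander_family ::
  "(nat \<Rightarrow> nat \<Rightarrow> real vec set) \<Rightarrow> (nat \<Rightarrow> nat \<Rightarrow> nat) \<Rightarrow> (nat \<Rightarrow> nat \<Rightarrow> real vec \<Rightarrow> real vec) \<Rightarrow>
   nat \<Rightarrow> real \<Rightarrow> (nat \<Rightarrow> real vec pair_pre_digraph) \<Rightarrow> bool"
where
  "explicit_expander_family \<Upsilon> C \<phi> d r G \<longleftrightarrow>
     (\<forall>\<^sub>F N in sequentially. pverts (G N) = \<Upsilon> 4 N \<and> expander_graph (G N) d r) \<and>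
     (\<exists>\<delta> a e. turing_machine \<delta> \<and>
        (\<forall>\<^sub>F N in sequentially. \<forall>s \<in> sign_vecs (C 4 N). \<exists>ss.
           distinct ss \<and> set ss \<subseteq> sign_vecs (C 4 N) \<and>
           \<phi> 4 N ` set ss = {w. (\<phi> 4 N s, w) \<in> parcs (G N)} \<and>
           computes_within \<delta> (enc_binary N @ [3] @ enc_signs s)
             (concat (map (\<lambda>s'. enc_signs s' @ [3]) ss)) (a * C 4 N ^ e)))"

text \<open>\<open>walk_from G v n\<close> is the law of the first \<open>n\<close> vertices of the random walk started at \<open>v\<close>.\<close>

primrec walk_from :: "'a pair_pre_digraph \<Rightarrow> 'a \<Rightarrow> nat \<Rightarrow> 'a list pmf" where
  "walk_from G v 0 = return_pmf []"
| "walk_from G v (Suc n) = map_pmf ((#) v)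
     (bind_pmf (pmf_of_set {w. (v, w) \<in> parcs G}) (\<lambda>w. walk_from G w n))"

definition random_walk :: "'a pair_pre_digraph \<Rightarrow> nat \<Rightarrow> 'a list pmf" where
  "random_walk G n = bind_pmf (pmf_of_set (pverts G)) (\<lambda>v. walk_from G v n)"

section \<open>The random matrices\<close>

definition A1_law :: "real vec set \<Rightarrow> nat \<Rightarrow> nat \<Rightarrow> real mat pmf" where
  "A1_law U n N = map_pmf (\<lambda>u. mat n N (\<lambda>(i, j). u $ (i * N + j))) (pmf_of_set U)"

definition A2_law :: "real vec pair_pre_digraph \<Rightarrow> nat \<Rightarrow> nat \<Rightarrow> real mat pmf" where
  "A2_law G n N = map_pmf (mat_of_rows N) (random_walk G n)"

end

theory Submission
  imports Defs "Jordan_Normal_Form.Schur_Decomposition" "HOL-Real_Asymp.Real_Asymp"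
begin

text \<open>
  Write \<open>A = A\<^sub>1 \<bullet> A\<^sub>2\<close>. If \<open>Ax = 0\<close>, \<open>\<parallel>x\<parallel>\<^sub>2 = 1\<close> and \<open>\<parallel>x\<parallel>\<^sub>1 < \<delta> \<surd>N\<close>, then rounding the coordinates of
  \<open>x\<close> towards \<open>0\<close> on a lattice of mesh \<open>\<epsilon>\<^sup>2 / (\<delta> \<surd>N)\<close> moves \<open>x\<close> by at most \<open>\<epsilon>\<close> in \<open>\<ell>\<^sub>2\<close> to a point \<open>z\<close> of an
  \<open>\<ell>\<^sub>1\<close>-ball of \<open>\<int>\<^sup>N\<close> of radius \<open>\<delta>\<^sup>2 N / \<epsilon>\<^sup>2\<close>; with \<open>\<epsilon>\<^sup>2\<close> of order \<open>\<xi>\<close> and \<open>\<delta>\<close> of order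
  \<open>\<xi> / \<surd>(log 1/\<xi>)\<close> there are at most \<open>exp (c n)\<close> such points.

  For a fixed \<open>z\<close> and fixed \<open>A\<^sub>1\<close>, the fourth moment of a 4-wise independent sum bounds the mean of
  \<open>exp (- (Az)\<^sub>i\<^sup>2 / 6)\<close> away from 1, and the spectral gap of the expander turns this into
  \<open>E exp (- \<parallel>Az\<parallel>\<^sup>2 / 6) \<le> \<rho>\<^sup>n\<close>, so \<open>\<parallel>Az\<parallel>\<^sup>2\<close> is at least of order \<open>n\<close> simultaneously on the net.

  The randomness of \<open>A\<^sub>1\<close> gives \<open>\<parallel>A\<parallel> \<le> C \<surd>N\<close>, which makes \<open>A (x - z) = - Az\<close> too small. The squared
  Frobenius norm of \<open>(A\<^sup>T A)\<^sup>j\<close> with \<open>4 j \<le> k\<close> has degree at most \<open>k\<close> in the entries of \<open>A\<^sub>1\<close>, so its mean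
  is the one for independent signs, for which the norm is controlled by exponential moments on a
  net; as \<open>k\<close> is of order \<open>log n\<close>, Markov's inequality suffices.
\<close>

section \<open>Spectral gap\<close>

definition mact :: "'a set \<Rightarrow> ('b \<Rightarrow> 'a \<Rightarrow> real) \<Rightarrow> ('a \<Rightarrow> real) \<Rightarrow> 'b \<Rightarrow> real" where
  "mact I A x i = (\<Sum>j\<in>I. A i j * x j)"

definition mmul :: "'a set \<Rightarrow> ('b \<Rightarrow> 'a \<Rightarrow> real) \<Rightarrow> ('a \<Rightarrow> 'c \<Rightarrow> real) \<Rightarrow> 'b \<Rightarrow> 'c \<Rightarrow> real" where
  "mmul I A B i j = (\<Sum>k\<in>I. A i k * B k j)"

definition sqn :: "'a set \<Rightarrow> ('a \<Rightarrow> real) \<Rightarrow> real" where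
  "sqn I x = (\<Sum>i\<in>I. (x i)\<^sup>2)"

definition frob :: "'b set \<Rightarrow> 'a set \<Rightarrow> ('b \<Rightarrow> 'a \<Rightarrow> real) \<Rightarrow> real" where
  "frob I J A = (\<Sum>i\<in>I. sqn J (A i))"

text \<open>The power A^(2^r). The exponent only has to tend to infinity, and a squaring step keeps
  symmetry, nonnegativity and unit row sums.\<close>

primrec msq :: "'a set \<Rightarrow> ('a \<Rightarrow> 'a \<Rightarrow> real) \<Rightarrow> nat \<Rightarrow> 'a \<Rightarrow> 'a \<Rightarrow> real" where
  "msq I A 0 = A"
| "msq I A (Suc r) = mmul I (msq I A r) (msq I A r)"

lemma sqn_nonneg [simp]: "0 \<le> sqn I x"
  unfolding sqn_def by (simp add: sum_nonneg)

lemma mact_mmul: "mact J (mmul I A B) x = mact I A (mact J B x)"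
proof
  fix i
  have "mact J (mmul I A B) x i = (\<Sum>j\<in>J. \<Sum>k\<in>I. A i k * B k j * x j)"
    unfolding mact_def mmul_def by (simp add: sum_distrib_right)
  also have "\<dots> = (\<Sum>k\<in>I. \<Sum>j\<in>J. A i k * B k j * x j)" by (rule sum.swap)
  also have "\<dots> = mact I A (mact J B x) i"
    unfolding mact_def by (simp add: sum_distrib_left mult.assoc)
  finally show "mact J (mmul I A B) x i = mact I A (mact J B x) i" .
qed

lemma mact_mult_sum:
  "(\<Sum>i\<in>I. y i * mact J A x i) = (\<Sum>j\<in>J. x j * mact I (\<lambda>j i. A i j) y j)"
proof -
  have "(\<Sum>i\<in>I. y i * mact J A x i) = (\<Sum>i\<in>I. \<Sum>j\<in>J. y i * (A i j * x j))"
    unfolding mact_def by (simp add: sum_distrib_left)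
  also have "\<dots> = (\<Sum>j\<in>J. \<Sum>i\<in>I. y i * (A i j * x j))" by (rule sum.swap)
  also have "\<dots> = (\<Sum>j\<in>J. x j * mact I (\<lambda>j i. A i j) y j)"
    unfolding mact_def by (simp add: sum_distrib_left mult_ac)
  finally show ?thesis .
qed

lemma sqn_mact_le_frob: "sqn I (mact J A x) \<le> frob I J A * sqn J x"
proof -
  have "(mact J A x i)\<^sup>2 \<le> sqn J (A i) * sqn J x" for i
    unfolding mact_def sqn_def by (rule Cauchy_Schwarz_ineq_sum)
  then show ?thesis
    unfolding frob_def sqn_def[of I] sum_distrib_right by (intro sum_mono) auto
qed

lemma msq_sym:
  assumes "\<And>i j. A i j = A j i" shows "msq I A r i j = msq I A r j i"
proof (induction r arbitrary: i j)
  case (Suc r)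
  show ?case by (simp add: mmul_def Suc[of i] Suc[of _ j] mult.commute)
qed (use assms in simp)

text \<open>By symmetry |Ax|^2 is the inner product of x with A^2 x; Cauchy-Schwarz then compares
  one power of \<open>A\<close> with the next.\<close>

lemma sqn_mact_sym:
  assumes "\<And>i j. A i j = A j i"
  shows "(sqn I (mact I A x))\<^sup>2 \<le> sqn I x * sqn I (mact I (mmul I A A) x)"
proof -
  have T: "(\<lambda>j i. A i j) = A" using assms by auto
  have "sqn I (mact I A x) = (\<Sum>i\<in>I. mact I A x i * mact I A x i)"
    by (simp add: sqn_def power2_eq_square)
  also have "\<dots> = (\<Sum>i\<in>I. x i * mact I (mmul I A A) x i)"
    by (subst mact_mult_sum) (simp only: T mact_mmul)
  finally show ?thesis using Cauchy_Schwarz_ineq_sum[of x "mact I (mmul I A A) x" I]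
    by (simp add: sqn_def)
qed

text \<open>Iterates \<open>sqn_mact_sym\<close>: on a unit vector, each squaring of the matrix
  squares the lower bound.\<close>

lemma sqn_mact_msq:
  assumes "\<And>i j. A i j = A j i" "sqn I x = 1"
  shows "sqn I (mact I A x) ^ (2 ^ r) \<le> sqn I (mact I (msq I A r) x)"
proof (induction r)
  case (Suc r)
  have "sqn I (mact I A x) ^ (2 ^ Suc r) = (sqn I (mact I A x) ^ (2 ^ r))\<^sup>2"
    by (simp add: power_mult[symmetric] mult.commute)
  also have "\<dots> \<le> (sqn I (mact I (msq I A r) x))\<^sup>2"
    using Suc by (intro power_mono) auto
  also have "\<dots> \<le> sqn I (mact I (msq I A (Suc r)) x)"
    using sqn_mact_sym[of "msq I A r" I x] msq_sym[of A, OF assms(1)] assms(2) by simp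
  finally show ?case .
qed simp

lemma msq_stochastic:
  assumes "\<And>i j. 0 \<le> T i j" "\<And>i. i \<in> I \<Longrightarrow> (\<Sum>j\<in>I. T i j) = 1"
  shows "0 \<le> msq I T r i j" "i \<in> I \<Longrightarrow> (\<Sum>j\<in>I. msq I T r i j) = 1"
proof (induction r arbitrary: i j)
  case (Suc r)
  { case 1 then show ?case by (auto simp: mmul_def intro!: sum_nonneg mult_nonneg_nonneg Suc) }
  { case 2
    have "(\<Sum>j\<in>I. msq I T (Suc r) i j) = (\<Sum>k\<in>I. \<Sum>j\<in>I. msq I T r i k * msq I T r k j)"
      by (simp add: mmul_def) (rule sum.swap)
    also have "\<dots> = (\<Sum>k\<in>I. msq I T r i k)"
      by (rule sum.cong) (auto simp: sum_distrib_left[symmetric] Suc)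
    finally show ?case using Suc 2 by simp }
qed (use assms in auto)

text \<open>Bessel's inequality for the pair \<open>x\<close>, \<open>y\<close> in every row, summed
  over the rows.\<close>

lemma frob_ge_orthonormal_pair:
  assumes fin: "finite I" and x: "sqn I x = 1" and y: "sqn I y = 1"
    and xy: "(\<Sum>i\<in>I. x i * y i) = 0"
  shows "sqn J (mact I A x) + sqn J (mact I A y) \<le> frob J I A"
proof -
  have "(mact I A x i)\<^sup>2 + (mact I A y i)\<^sup>2 \<le> sqn I (A i)" for i
  proof -
    define a where "a = mact I A x i"
    define b where "b = mact I A y i"
    have "0 \<le> sqn I (\<lambda>j. A i j - a * x j - b * y j)" by simp
    also have "\<dots> = (\<Sum>j\<in>I. (A i j)\<^sup>2 - 2 * a * (A i j * x j) - 2 * b * (A i j * y j)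
        + a\<^sup>2 * (x j)\<^sup>2 + b\<^sup>2 * (y j)\<^sup>2 + 2 * a * b * (x j * y j))"
      unfolding sqn_def by (rule sum.cong) (auto simp: power2_eq_square algebra_simps)
    also have "\<dots> = sqn I (A i) - 2 * a * a - 2 * b * b + a\<^sup>2 * sqn I x + b\<^sup>2 * sqn I y
        + 2 * a * b * (\<Sum>i\<in>I. x i * y i)"
      by (simp add: sum.distrib sum_subtractf sum_distrib_left[symmetric] sqn_def a_def b_def mact_def)
    finally show ?thesis using x y xy by (simp add: a_def[symmetric] b_def[symmetric] power2_eq_square)
  qed
  then show ?thesis unfolding frob_def sqn_def[of J] sum.distrib[symmetric] by (intro sum_mono) auto
qed

text \<open>Trace method: the Frobenius norm of a high power of \<open>T\<close> dominates the contributions of the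
  constant vector and of \<open>g\<close>, and equals the corresponding power sum of the eigenvalues.\<close>

lemma spectral_gap_of_power_sums:
  fixes T :: "'a \<Rightarrow> 'a \<Rightarrow> real"
  assumes fin: "finite I" and sym: "\<And>i j. T i j = T j i" and nn: "\<And>i j. 0 \<le> T i j"
    and row: "\<And>i. i \<in> I \<Longrightarrow> (\<Sum>j\<in>I. T i j) = 1"
    and ls: "\<And>r. frob I I (msq I T r) = (\<Sum>l\<leftarrow>l0 # ls. l ^ (2 * 2 ^ r))"
    and small: "\<And>l. l \<in> set ls \<Longrightarrow> \<bar>l\<bar> \<le> \<mu>" and \<mu>: "0 < \<mu>"
    and g: "(\<Sum>i\<in>I. g i) = 0"
  shows "sqn I (mact I T g) \<le> \<mu>\<^sup>2 * sqn I g"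
proof (cases "sqn I g = 0")
  case True
  then have "g i = 0" if "i \<in> I" for i
    using fin that by (auto simp: sqn_def sum_nonneg_eq_0_iff)
  then show ?thesis by (simp add: sqn_def mact_def)
next
  case False
  then have I: "I \<noteq> {}" and Ic: "0 < card I" using fin by (auto simp: sqn_def card_gt_0_iff)
  define h where "h = (\<lambda>i. g i / sqrt (sqn I g))"
  have g0: "0 < sqn I g" using False by (simp add: order_le_neq_trans)
  have sc: "sqn I (\<lambda>i. x i / c) = sqn I x / c\<^sup>2" for x :: "'a \<Rightarrow> real" and c
    by (simp add: sqn_def power_divide sum_divide_distrib)
  have h1: "sqn I h = 1" using g0 by (simp add: h_def sc)
  have Th: "mact I T h = (\<lambda>i. mact I T g i / sqrt (sqn I g))"
    by (auto simp: mact_def h_def sum_divide_distrib)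
  \<comment> \<open>The normalised constant vector, fixed by the stochastic matrix \<open>T\<close>
    and orthogonal to \<open>h\<close>.\<close>
  define e where "e = (\<lambda>i::'a. 1 / sqrt (real (card I)))"
  have e1: "sqn I e = 1" using Ic by (simp add: sqn_def e_def power_divide)
  have eh: "(\<Sum>i\<in>I. e i * h i) = 0"
    using g by (simp add: e_def h_def sum_divide_distrib[symmetric])
  \<comment> \<open>The entries of a stochastic matrix lie in [0, 1], so their squares sum to at
    most 1 in each row, uniformly in \<open>r\<close>.\<close>
  have F: "frob I I (msq I T r) \<le> real (card I)" for r
  proof -
    note st = msq_stochastic[of T I, OF nn row]
    have "sqn I (msq I T r i) \<le> 1" if i: "i \<in> I" for i
    proof -
      have le1: "msq I T r i j \<le> 1" if "j \<in> I" for j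
        using member_le_sum[OF that, of "msq I T r i"] st(1) st(2)[OF _ i] fin by auto
      have "sqn I (msq I T r i) \<le> (\<Sum>j\<in>I. msq I T r i j)"
        unfolding sqn_def power2_eq_square
        by (intro sum_mono mult_left_le) (auto simp: st le1)
      then show ?thesis using st(2)[OF _ i] by simp
    qed
    then have "frob I I (msq I T r) \<le> (\<Sum>i\<in>I. 1)" unfolding frob_def by (intro sum_mono) auto
    then show ?thesis by simp
  qed
  \<comment> \<open>As 2^r tends to infinity, the constant \<open>c\<close> disappears on taking
    roots. Applied to the square of \<open>l0\<close> and to the ratio of |Th|^2 to \<mu>^2.\<close>
  have power_bound: "b \<le> 1" if b: "0 \<le> b" "\<And>r. b ^ (2 ^ r) \<le> c" for b c :: real
  proof (rule ccontr)
    assume "\<not> b \<le> 1"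
    then obtain m where m: "c < b ^ m" using real_arch_pow[of b c] by auto
    have "m \<le> 2 ^ m" by (simp add: less_imp_le)
    then have "b ^ m \<le> b ^ (2 ^ m)" using \<open>\<not> b \<le> 1\<close> by (intro power_increasing) auto
    then show False using m b(2)[of m] by simp
  qed
  have l0: "l0\<^sup>2 \<le> 1"
  proof (rule power_bound[of _ "real (card I)"])
    fix r
    have "(l0\<^sup>2) ^ (2 ^ r) \<le> (\<Sum>l\<leftarrow>l0 # ls. l ^ (2 * 2 ^ r))"
      by (auto simp: power_mult intro!: sum_list_nonneg)
    then show "(l0\<^sup>2) ^ (2 ^ r) \<le> real (card I)" using F[of r] ls[of r] by simp
  qed simp
  \<comment> \<open>The vector \<open>e\<close> contributes exactly 1 to the Frobenius norm and
    \<open>l0\<close> at most 1 to the power sum. After cancelling, powers of |Th|^2 are bounded by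
    \<open>length ls\<close> times powers of \<mu>^2.\<close>
  have le: "sqn I (mact I T h) / \<mu>\<^sup>2 \<le> 1"
  proof (rule power_bound[of _ "real (length ls)"])
    fix r
    have "mact I (msq I T r) e i = e i" if "i \<in> I" for i
      using msq_stochastic(2)[of T I i r, OF nn row that]
      by (simp add: mact_def e_def sum_divide_distrib[symmetric])
    then have Ae: "sqn I (mact I (msq I T r) e) = 1" using e1 by (simp add: sqn_def)
    have "(\<Sum>l\<leftarrow>ls. l ^ (2 * 2 ^ r)) \<le> (\<Sum>l\<leftarrow>ls. (\<mu>\<^sup>2) ^ 2 ^ r)"
    proof (rule sum_list_mono)
      fix l assume "l \<in> set ls"
      then have "l\<^sup>2 \<le> \<mu>\<^sup>2" using small[of l] by (simp add: abs_le_square_iff[symmetric])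
      then show "l ^ (2 * 2 ^ r) \<le> (\<mu>\<^sup>2) ^ 2 ^ r" by (simp add: power_mult power_mono)
    qed
    also have "\<dots> = length ls * (\<mu>\<^sup>2) ^ 2 ^ r" by (simp add: sum_list_const_mult sum_list_triv)
    finally have tail: "(\<Sum>l\<leftarrow>ls. l ^ (2 * 2 ^ r)) \<le> length ls * (\<mu>\<^sup>2) ^ 2 ^ r" .
    have "sqn I (mact I T h) ^ (2 ^ r) + 1 \<le> sqn I (mact I (msq I T r) h) + 1"
      using sqn_mact_msq[of T I h r, OF sym h1] by simp
    also have "\<dots> \<le> frob I I (msq I T r)"
      using frob_ge_orthonormal_pair[OF fin e1 h1 eh, of I "msq I T r"] Ae by simp
    also have "\<dots> = (l0\<^sup>2) ^ 2 ^ r + (\<Sum>l\<leftarrow>ls. l ^ (2 * 2 ^ r))" by (simp add: ls power_mult)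
    also have "\<dots> \<le> 1 + length ls * (\<mu>\<^sup>2) ^ 2 ^ r" using l0 tail by (simp add: power_le_one add_mono)
    finally show "(sqn I (mact I T h) / \<mu>\<^sup>2) ^ 2 ^ r \<le> real (length ls)"
      using \<mu> by (simp add: power_divide divide_simps)
  qed (use \<mu> in simp)
  have "sqn I (mact I T g) = sqn I (mact I T h) * sqn I g"
    unfolding Th sc using g0 by simp
  also have "\<dots> \<le> \<mu>\<^sup>2 * sqn I g"
    using le \<mu> by (intro mult_right_mono) (auto simp: divide_le_eq)
  finally show ?thesis .
qed

section \<open>Power sums of eigenvalues as traces of iterated squares\<close>

fun mat_sq_iter :: "real mat \<Rightarrow> nat \<Rightarrow> real mat" where
  "mat_sq_iter A 0 = A"
| "mat_sq_iter A (Suc r) = mat_sq_iter A r * mat_sq_iter A r"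

lemma mat_sq_iter_carrier:
  "A \<in> carrier_mat n n \<Longrightarrow> mat_sq_iter A r \<in> carrier_mat n n"
  by (induction r) auto

lemma similar_mat_wit_square:
  fixes A :: "real mat"
  assumes "similar_mat_wit A B P Q" shows "similar_mat_wit (A * A) (B * B) P Q"
proof -
  define n where "n = dim_row A"
  note w = similar_mat_witD[OF n_def assms]
  have "A * A = P * B * (Q * (P * (B * Q)))" unfolding w(3) using w(4-7)
    by (simp add: assoc_mult_mat[of _ n n _ n _ n])
  also have "\<dots> = P * B * ((Q * P) * (B * Q))" using w(4-7)
    by (simp add: assoc_mult_mat[of _ n n _ n _ n])
  also have "\<dots> = P * (B * B) * Q" using w(2,4-7)
    by (simp add: assoc_mult_mat[of _ n n _ n _ n])
  finally show ?thesis using w by (intro similar_mat_witI) auto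
qed

lemma upper_triangular_square:
  fixes B :: "real mat"
  assumes B: "B \<in> carrier_mat n n" and u: "upper_triangular B"
  shows "upper_triangular (B * B)" "diag_mat (B * B) = map (\<lambda>x. x\<^sup>2) (diag_mat B)"
proof -
  show "upper_triangular (B * B)"
  proof (rule upper_triangularI)
    fix i j assume ij: "j < i" "i < dim_row (B * B)"
    have "B $$ (i, k) * B $$ (k, j) = 0" if "k < n" for k
      using u ij that B by (cases "k < i") (auto simp: upper_triangular_def)
    then show "(B * B) $$ (i, j) = 0" using ij B by (auto simp: scalar_prod_def intro!: sum.neutral)
  qed
  have "(B * B) $$ (i, i) = (B $$ (i, i))\<^sup>2" if i: "i < n" for i
  proof -
    have z: "B $$ (i, k) * B $$ (k, i) = 0" if "k < n" "k \<noteq> i" for k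
      using u i that B by (cases "k < i") (auto simp: upper_triangular_def)
    have "(B * B) $$ (i, i) = (\<Sum>k<n. B $$ (i, k) * B $$ (k, i))"
      using i B by (auto simp: scalar_prod_def lessThan_atLeast0)
    also have "\<dots> = (\<Sum>k<n. if k = i then (B $$ (i, i))\<^sup>2 else 0)"
      using z by (intro sum.cong) (auto simp: power2_eq_square)
    finally show ?thesis using i by simp
  qed
  then show "diag_mat (B * B) = map (\<lambda>x. x\<^sup>2) (diag_mat B)"
    using B by (auto simp: diag_mat_def)
qed

lemma sum_list_diag_mult_comm:
  fixes A B :: "real mat"
  assumes A: "A \<in> carrier_mat n n" and B: "B \<in> carrier_mat n n"
  shows "sum_list (diag_mat (A * B)) = sum_list (diag_mat (B * A))"
proof -
  have *: "sum_list (diag_mat (A * B)) = (\<Sum>i<n. \<Sum>k<n. A $$ (i, k) * B $$ (k, i))"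
    if "A \<in> carrier_mat n n" "B \<in> carrier_mat n n" for A B :: "real mat"
    using that by (auto simp: diag_mat_def sum_list_sum_nth scalar_prod_def lessThan_atLeast0 intro!: sum.cong)
  show ?thesis unfolding *[OF A B] *[OF B A] by (subst sum.swap) (simp add: mult.commute)
qed

text \<open>The Schur form is triangular with diagonal \<open>ls\<close>. Squaring keeps it
  triangular and squares the diagonal, and the trace is invariant under conjugation.\<close>

lemma trace_mat_sq_iter:
  fixes A :: "real mat"
  assumes A: "A \<in> carrier_mat n n" and c: "char_poly A = (\<Prod>l\<leftarrow>ls. [:- l, 1:])"
  shows "sum_list (diag_mat (mat_sq_iter A r)) = (\<Sum>l\<leftarrow>ls. l ^ (2 ^ r))"
proof -
  obtain B P Q where "schur_decomposition A ls = (B, P, Q)" by (metis prod_cases3)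
  from schur_decomposition[OF A c this]
  have w: "similar_mat_wit A B P Q" and u: "upper_triangular B" and d: "diag_mat B = ls" by auto
  note BPQ = similar_mat_witD2(1,2,5,6,7)[OF A w]
  have wr: "similar_mat_wit (mat_sq_iter A r) (mat_sq_iter B r) P Q"
    by (induction r) (use w similar_mat_wit_square in auto)
  have ur: "upper_triangular (mat_sq_iter B r) \<and>
      diag_mat (mat_sq_iter B r) = map (\<lambda>l. l ^ (2 ^ r)) ls" for r
  proof (induction r)
    case (Suc r)
    then show ?case using upper_triangular_square[OF mat_sq_iter_carrier[OF BPQ(3)], of r]
      by (auto simp: power_mult[symmetric] mult.commute)
  qed (use u d in auto)
  note C = mat_sq_iter_carrier[OF BPQ(3), of r]
  have "sum_list (diag_mat (mat_sq_iter A r)) = sum_list (diag_mat (P * (mat_sq_iter B r * Q)))"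
    using similar_mat_witD2(3)[OF mat_sq_iter_carrier[OF A] wr] BPQ C
    by (simp add: assoc_mult_mat[of _ n n _ n _ n])
  also have "\<dots> = sum_list (diag_mat (mat_sq_iter B r * Q * P))"
    using BPQ C by (intro sum_list_diag_mult_comm) auto
  also have "mat_sq_iter B r * Q * P = mat_sq_iter B r"
    using BPQ C by (simp add: assoc_mult_mat[of _ n n _ n _ n])
  finally show ?thesis using ur[of r] by simp
qed

text \<open>For a symmetric matrix the squared Frobenius norm is the trace of the square, that is,
  of the next iterate; hence the exponent \<open>2 * 2 ^ r\<close>.\<close>

lemma frob_msq_eq_power_sum:
  assumes vs: "distinct vs" "set vs = I" and sym: "\<And>i j. T i j = T j i"
    and c: "char_poly (mat (length vs) (length vs) (\<lambda>(i, j). T (vs ! i) (vs ! j)))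
      = (\<Prod>l\<leftarrow>ls. [:- l, 1:])"
  shows "frob I I (msq I T r) = (\<Sum>l\<leftarrow>ls. l ^ (2 * 2 ^ r))"
proof -
  define n where "n = length vs"
  define M where "M = (\<lambda>r. mat n n (\<lambda>(i, j). msq I T r (vs ! i) (vs ! j)))"
  have b: "bij_betw ((!) vs) {..<n} I" using vs by (intro bij_betw_nth) (auto simp: n_def)
  have S: "M (Suc r) = M r * M r" for r
  proof (rule eq_matI)
    fix i j assume "i < dim_row (M r * M r)" "j < dim_col (M r * M r)"
    then show "M (Suc r) $$ (i, j) = (M r * M r) $$ (i, j)"
      by (auto simp: M_def mmul_def scalar_prod_def lessThan_atLeast0[symmetric]
          sum.reindex_bij_betw[OF b, symmetric])
  qed (auto simp: M_def)
  have M: "M r = mat_sq_iter (M 0) r" for r by (induction r) (auto simp: S)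
  have "frob I I (msq I T r) = (\<Sum>i\<in>I. msq I T (Suc r) i i)"
    unfolding frob_def sqn_def
    by (auto simp: mmul_def power2_eq_square msq_sym[of T I r, OF sym] intro!: sum.cong)
  also have "\<dots> = (\<Sum>i<n. msq I T (Suc r) (vs ! i) (vs ! i))"
    by (rule sum.reindex_bij_betw[OF b, symmetric])
  also have "\<dots> = sum_list (diag_mat (M (Suc r)))"
    by (simp add: M_def diag_mat_def sum_list_sum_nth lessThan_atLeast0)
  also have "\<dots> = (\<Sum>l\<leftarrow>ls. l ^ (2 ^ Suc r))"
    by (subst M, rule trace_mat_sq_iter[of _ n]) (use c in \<open>auto simp: M_def n_def\<close>)
  finally show ?thesis by simp
qed

section \<open>Products along an expander walk\<close>

text \<open>The entries of \<open>transition_matrix\<close>, indexed by the vertices themselves so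
  that no enumeration enters the analysis of the walk.\<close>

definition walk_kernel :: "'a pair_pre_digraph \<Rightarrow> nat \<Rightarrow> 'a \<Rightarrow> 'a \<Rightarrow> real" where
  "walk_kernel G d u v = (if (u, v) \<in> parcs G then 1 / real d else 0)"

lemma regular_graphD:
  assumes "regular_graph G d"
  shows "finite (pverts G)" "(u, v) \<in> parcs G \<longleftrightarrow> (v, u) \<in> parcs G"
    "(u, v) \<in> parcs G \<Longrightarrow> v \<in> pverts G"
    "u \<in> pverts G \<Longrightarrow> card {w. (u, w) \<in> parcs G} = d"
proof -
  interpret pair_graph G using assms by (simp add: regular_graph_def)
  show "finite (pverts G)" by (rule pair_finite_verts)
  show "(u, v) \<in> parcs G \<longleftrightarrow> (v, u) \<in> parcs G"
    using pair_sym_arcs by (auto simp: symmetric_def sym_def)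
  show "(u, v) \<in> parcs G \<Longrightarrow> v \<in> pverts G" using arc_snd_in_verts by fastforce
  show "u \<in> pverts G \<Longrightarrow> card {w. (u, w) \<in> parcs G} = d"
    using assms by (simp add: regular_graph_def)
qed

lemma walk_kernel_nbrs:
  assumes G: "regular_graph G d"
  shows "mact (pverts G) (walk_kernel G d) g v = (\<Sum>w | (v, w) \<in> parcs G. g w) / real d"
proof -
  have "mact (pverts G) (walk_kernel G d) g v
      = (\<Sum>w\<in>pverts G. if (v, w) \<in> parcs G then g w / real d else 0)"
    unfolding mact_def walk_kernel_def by (intro sum.cong) auto
  also have "\<dots> = (\<Sum>w\<in>{w \<in> pverts G. (v, w) \<in> parcs G}. g w / real d)"
    using regular_graphD(1)[OF G] by (simp add: sum.inter_filter)
  also have "{w \<in> pverts G. (v, w) \<in> parcs G} = {w. (v, w) \<in> parcs G}"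
    using regular_graphD(3)[OF G] by auto
  finally show ?thesis by (simp add: sum_divide_distrib)
qed

lemma walk_kernel_row_sum:
  assumes G: "regular_graph G d" and d: "0 < d" and v: "v \<in> pverts G"
  shows "(\<Sum>w\<in>pverts G. walk_kernel G d v w) = 1"
  using walk_kernel_nbrs[OF G, of "\<lambda>_. 1" v] regular_graphD(4)[OF G v] d
  by (simp add: mact_def)

text \<open>The head of the eigenvalue list takes the role of \<open>l0\<close>; all later entries
  are bounded by the maximum in \<open>expander_graph\<close>.\<close>

lemma expander_spectral_gap:
  assumes G: "expander_graph G d q" and d: "0 < d" and q: "0 < q" and V: "pverts G \<noteq> {}"
    and g: "(\<Sum>v\<in>pverts G. g v) = 0"
  shows "sqn (pverts G) (mact (pverts G) (walk_kernel G d) g) \<le> q\<^sup>2 * sqn (pverts G) g"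
proof -
  from G have reg: "regular_graph G d" by (simp add: expander_graph_def)
  from G obtain ls vs where vs: "distinct vs" "set vs = pverts G"
    and c: "char_poly (transition_matrix G d vs) = (\<Prod>l\<leftarrow>ls. [:- l, 1:])"
    and m: "(MAX i\<in>{1..<length ls}. \<bar>ls ! i\<bar>) < q"
    unfolding expander_graph_def walk_eigenvalues_def by blast
  have tm: "transition_matrix G d vs
      = mat (length vs) (length vs) (\<lambda>(i, j). walk_kernel G d (vs ! i) (vs ! j))"
    by (auto simp: transition_matrix_def walk_kernel_def)
  have sym: "walk_kernel G d u v = walk_kernel G d v u" for u v
    using regular_graphD(2)[OF reg] by (auto simp: walk_kernel_def)
  have "ls \<noteq> []"
  proof
    assume "ls = []"
    then have "degree (char_poly (transition_matrix G d vs)) = 0" using c by simp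
    moreover have "degree (char_poly (transition_matrix G d vs)) = length vs"
      using degree_monic_char_poly[of "transition_matrix G d vs" "length vs"] by (simp add: tm)
    ultimately show False using vs V by auto
  qed
  then obtain l0 ls' where ls: "ls = l0 # ls'" by (cases ls) auto
  show ?thesis
  proof (rule spectral_gap_of_power_sums[where ?l0.0 = l0 and ls = ls'])
    show "frob (pverts G) (pverts G) (msq (pverts G) (walk_kernel G d) r)
        = (\<Sum>l\<leftarrow>l0 # ls'. l ^ (2 * 2 ^ r))" for r
      using frob_msq_eq_power_sum[OF vs sym c[unfolded tm]] ls by simp
    show "\<bar>l\<bar> \<le> q" if "l \<in> set ls'" for l
    proof -
      from that obtain i where i: "i < length ls'" "ls' ! i = l" by (auto simp: in_set_conv_nth)
      then have "\<bar>l\<bar> \<le> (MAX i\<in>{1..<length ls}. \<bar>ls ! i\<bar>)"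
        by (intro Max_ge) (auto simp: ls intro!: image_eqI[of _ _ "Suc i"])
      then show ?thesis using m by simp
    qed
  qed (use regular_graphD(1)[OF reg] sym walk_kernel_row_sum[OF reg d] q g in
      \<open>auto simp: walk_kernel_def\<close>)
qed

lemma L2_set_sqn: "L2_set f A = sqrt (sqn A f)"
  by (simp add: L2_set_def sqn_def)

text \<open>The kernel acts as \<open>1 - q\<close> times the averaging operator plus \<open>q\<close> times a contraction,
  and multiplication by \<open>f\<close> shrinks the constants produced by averaging.\<close>

lemma expander_step:
  assumes G: "expander_graph G d q" and d: "0 < d" and q: "0 < q" "q \<le> 1" and V: "pverts G \<noteq> {}"
    and f1: "\<And>v. v \<in> pverts G \<Longrightarrow> \<bar>f v\<bar> \<le> 1"
    and f2: "sqn (pverts G) f \<le> p\<^sup>2 * real (card (pverts G))" and p: "0 \<le> p"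
  shows "L2_set (\<lambda>v. f v * mact (pverts G) (walk_kernel G d) g v) (pverts G)
    \<le> ((1 - q) * p + q) * L2_set g (pverts G)"
proof -
  define I where "I = pverts G"
  define T where "T = walk_kernel G d"
  from G have reg: "regular_graph G d" by (simp add: expander_graph_def)
  have fin: "finite I" using regular_graphD(1)[OF reg] by (simp add: I_def)
  have c0: "0 < real (card I)" using fin V by (simp add: I_def card_gt_0_iff)
  have row: "(\<Sum>j\<in>I. T i j) = 1" if "i \<in> I" for i
    using walk_kernel_row_sum[OF reg d] that by (simp add: I_def T_def)
  have col: "(\<Sum>i\<in>I. T i j) = 1" if "j \<in> I" for j
  proof -
    have "T i j = T j i" for i using regular_graphD(2)[OF reg] by (auto simp: T_def walk_kernel_def)
    then show ?thesis using row[OF that] by simp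
  qed
  define a where "a = (\<Sum>i\<in>I. g i) / card I"
  define h where "h = (\<lambda>i. g i - a)"
  have h0: "(\<Sum>i\<in>I. h i) = 0" using c0 by (simp add: h_def a_def sum_subtractf)
  have Tg: "mact I T g i = a + mact I T h i" if "i \<in> I" for i
  proof -
    have "mact I T h i = mact I T g i - (\<Sum>j\<in>I. T i j) * a"
      unfolding mact_def h_def by (simp add: algebra_simps sum_subtractf sum_distrib_left)
    then show ?thesis using row[OF that] by simp
  qed
  \<comment> \<open>Symmetry makes the column sums 1 as well, so \<open>T\<close> preserves mean
    zero and constants stay orthogonal to the image of \<open>h\<close>.\<close>
  have Th0: "(\<Sum>i\<in>I. mact I T h i) = 0"
  proof -
    have "(\<Sum>i\<in>I. mact I T h i) = (\<Sum>j\<in>I. \<Sum>i\<in>I. T i j * h j)"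
      unfolding mact_def by (rule sum.swap)
    also have "\<dots> = (\<Sum>j\<in>I. h j)"
      by (rule sum.cong) (auto simp: sum_distrib_right[symmetric] col)
    finally show ?thesis using h0 by simp
  qed
  have pyth: "sqn I (\<lambda>i. b + x i) = b\<^sup>2 * card I + sqn I x" if "(\<Sum>i\<in>I. x i) = 0" for b x
    using that unfolding sqn_def
    by (simp add: power2_sum sum.distrib sum_distrib_left[symmetric] mult.assoc)
  have gap: "sqn I (mact I T h) \<le> q\<^sup>2 * sqn I h"
    using expander_spectral_gap[OF G d q(1) V, of h] h0 by (simp add: I_def T_def)
  have gh: "sqn I g = a\<^sup>2 * card I + sqn I h"
    using pyth[OF h0, of a] by (simp add: h_def)
  \<comment> \<open>This is what remains of Tg after removing (1 - q) a. By orthogonality and the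
    gap its norm is at most \<open>q\<close> times that of \<open>g\<close>.\<close>
  have "sqn I (\<lambda>i. q * a + mact I T h i) = q\<^sup>2 * (a\<^sup>2 * card I) + sqn I (mact I T h)"
    using pyth[OF Th0, of "q * a"] by (simp add: power_mult_distrib)
  also have "\<dots> \<le> q\<^sup>2 * sqn I g" using gap by (simp add: gh distrib_left)
  finally have r1: "sqn I (\<lambda>i. q * a + mact I T h i) \<le> q\<^sup>2 * sqn I g" .
  have "sqn I (\<lambda>i. f i * (q * a + mact I T h i)) \<le> sqn I (\<lambda>i. q * a + mact I T h i)"
    unfolding sqn_def
  proof (intro sum_mono)
    fix i assume "i \<in> I"
    then have "(f i)\<^sup>2 \<le> 1" using f1 by (simp add: I_def abs_square_le_1)
    then show "(f i * (q * a + mact I T h i))\<^sup>2 \<le> (q * a + mact I T h i)\<^sup>2"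
      by (simp add: power_mult_distrib mult_left_le_one_le)
  qed
  with r1 have "sqn I (\<lambda>i. f i * (q * a + mact I T h i)) \<le> q\<^sup>2 * sqn I g" by simp
  from real_sqrt_le_mono[OF this]
  have A: "L2_set (\<lambda>i. f i * (q * a + mact I T h i)) I \<le> q * L2_set g I"
    using q by (simp add: L2_set_sqn real_sqrt_mult)
  \<comment> \<open>On the constant part, multiplication by \<open>f\<close> gains the factor
    \<open>p\<close> through the mean square of \<open>f\<close>.\<close>
  have "sqn I (\<lambda>i. (1 - q) * a * f i) = (1 - q)\<^sup>2 * a\<^sup>2 * sqn I f"
    by (simp add: sqn_def power_mult_distrib sum_distrib_left)
  also have "\<dots> \<le> (1 - q)\<^sup>2 * a\<^sup>2 * (p\<^sup>2 * card I)"
    using f2 by (intro mult_left_mono) (auto simp: I_def)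
  also have "\<dots> = ((1 - q) * p)\<^sup>2 * (a\<^sup>2 * card I)"
    by (simp add: power_mult_distrib mult_ac)
  also have "\<dots> \<le> ((1 - q) * p)\<^sup>2 * sqn I g"
    unfolding gh by (intro mult_left_mono) auto
  finally have "sqn I (\<lambda>i. (1 - q) * a * f i) \<le> ((1 - q) * p)\<^sup>2 * sqn I g" .
  from real_sqrt_le_mono[OF this]
  have B: "L2_set (\<lambda>i. (1 - q) * a * f i) I \<le> (1 - q) * p * L2_set g I"
    using q p by (simp add: L2_set_sqn real_sqrt_mult)
  have "L2_set (\<lambda>v. f v * mact I T g v) I
      = L2_set (\<lambda>i. (1 - q) * a * f i + f i * (q * a + mact I T h i)) I"
    by (rule L2_set_cong) (auto simp: Tg algebra_simps)
  also have "\<dots> \<le> L2_set (\<lambda>i. (1 - q) * a * f i) I + L2_set (\<lambda>i. f i * (q * a + mact I T h i)) I"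
    by (rule L2_set_triangle_ineq)
  also have "\<dots> \<le> ((1 - q) * p + q) * L2_set g I" using A B by (simp add: distrib_right)
  finally show ?thesis by (simp add: I_def T_def)
qed

section \<open>Expectations along the random walk\<close>

lemma walk_from_support:
  assumes G: "regular_graph G d" and d: "0 < d" and v: "v \<in> pverts G"
  shows "finite (set_pmf (walk_from G v n))"
    "vs \<in> set_pmf (walk_from G v n) \<Longrightarrow> length vs = n \<and> set vs \<subseteq> pverts G"
proof -
  have "finite (set_pmf (walk_from G v n)) \<and>
      (\<forall>vs\<in>set_pmf (walk_from G v n). length vs = n \<and> set vs \<subseteq> pverts G)"
    using v
  proof (induction n arbitrary: v)
    case (Suc n)
    have c: "card {w. (v, w) \<in> parcs G} = d" using regular_graphD(4)[OF G Suc.prems] .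
    then have ne: "{w. (v, w) \<in> parcs G} \<noteq> {}" "finite {w. (v, w) \<in> parcs G}"
      using d card_gt_0_iff[of "{w. (v, w) \<in> parcs G}"] by simp_all
    show ?case using Suc.IH[OF regular_graphD(3)[OF G]] Suc.prems ne
      by (auto simp: set_bind_pmf set_pmf_of_set[OF ne])
  qed auto
  then show "finite (set_pmf (walk_from G v n))"
    "vs \<in> set_pmf (walk_from G v n) \<Longrightarrow> length vs = n \<and> set vs \<subseteq> pverts G" by auto
qed

lemma random_walk_support:
  assumes G: "regular_graph G d" and d: "0 < d" and V: "pverts G \<noteq> {}"
  shows "finite (set_pmf (random_walk G n))"
    "vs \<in> set_pmf (random_walk G n) \<Longrightarrow> length vs = n \<and> set vs \<subseteq> pverts G"
proof -
  have "set_pmf (random_walk G n) = (\<Union>v\<in>pverts G. set_pmf (walk_from G v n))"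
    using regular_graphD(1)[OF G] V by (simp add: random_walk_def set_bind_pmf set_pmf_of_set)
  then show "finite (set_pmf (random_walk G n))"
    "vs \<in> set_pmf (random_walk G n) \<Longrightarrow> length vs = n \<and> set vs \<subseteq> pverts G"
    using walk_from_support[OF G d] regular_graphD(1)[OF G] by (simp, blast)
qed

text \<open>Markov property at the first step: the remaining vertices form a walk from a uniform
  neighbour, and the functions shift by one index.\<close>

lemma walk_from_expectation_Suc:
  fixes f :: "nat \<Rightarrow> 'a \<Rightarrow> real"
  assumes G: "regular_graph G d" and d: "0 < d" and v: "v \<in> pverts G"
  shows "measure_pmf.expectation (walk_from G v (Suc n)) (\<lambda>vs. \<Prod>i<Suc n. f i (vs ! i))
    = f 0 v * mact (pverts G) (walk_kernel G d)
        (\<lambda>w. measure_pmf.expectation (walk_from G w n) (\<lambda>vs. \<Prod>i<n. f (Suc i) (vs ! i))) v"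
proof -
  have c: "card {w. (v, w) \<in> parcs G} = d" using regular_graphD(4)[OF G v] .
  then have ne: "{w. (v, w) \<in> parcs G} \<noteq> {}" "finite {w. (v, w) \<in> parcs G}"
    using d card_gt_0_iff[of "{w. (v, w) \<in> parcs G}"] by simp_all
  have "measure_pmf.expectation (walk_from G v (Suc n)) (\<lambda>vs. \<Prod>i<Suc n. f i (vs ! i))
    = measure_pmf.expectation (bind_pmf (pmf_of_set {w. (v, w) \<in> parcs G}) (\<lambda>w. walk_from G w n))
      (\<lambda>vs. f 0 v * (\<Prod>i<n. f (Suc i) (vs ! i)))"
    unfolding walk_from.simps integral_map_pmf by (simp add: prod.lessThan_Suc_shift del: prod.lessThan_Suc)
  also have "\<dots> = (\<Sum>w\<in>{w. (v, w) \<in> parcs G}.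
      measure_pmf.expectation (walk_from G w n) (\<lambda>vs. f 0 v * (\<Prod>i<n. f (Suc i) (vs ! i))) /\<^sub>R d)"
    by (subst pmf_expectation_bind_pmf_of_set[OF ne])
      (use walk_from_support(1)[OF G d] regular_graphD(3)[OF G] c in auto)
  also have "\<dots> = f 0 v * mact (pverts G) (walk_kernel G d)
        (\<lambda>w. measure_pmf.expectation (walk_from G w n) (\<lambda>vs. \<Prod>i<n. f (Suc i) (vs ! i))) v"
    unfolding walk_kernel_nbrs[OF G]
    by (simp add: sum_distrib_left divide_inverse mult_ac)
  finally show ?thesis .
qed

text \<open>The expectation arises from the constant 1 by alternately applying the kernel and
  multiplying by some \<open>f i\<close>; each such pair contracts the L2 norm as in
  \<open>expander_step\<close>.\<close>

lemma expander_walk_product: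
  fixes f :: "nat \<Rightarrow> 'a \<Rightarrow> real"
  assumes G: "expander_graph G d q" and d: "0 < d" and q: "0 < q" "q \<le> 1" and V: "pverts G \<noteq> {}"
    and f1: "\<And>i v. i < n \<Longrightarrow> v \<in> pverts G \<Longrightarrow> \<bar>f i v\<bar> \<le> 1"
    and f2: "\<And>i. i < n \<Longrightarrow> sqn (pverts G) (f i) \<le> p\<^sup>2 * real (card (pverts G))" and p: "0 \<le> p"
  shows "measure_pmf.expectation (random_walk G n) (\<lambda>vs. \<Prod>i<n. f i (vs ! i))
    \<le> ((1 - q) * p + q) ^ n"
proof -
  define I where "I = pverts G"
  define r where "r = (1 - q) * p + q"
  define E where "E = (\<lambda>n (f :: nat \<Rightarrow> 'a \<Rightarrow> real) v.
    measure_pmf.expectation (walk_from G v n) (\<lambda>vs. \<Prod>i<n. f i (vs ! i)))"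
  from G have reg: "regular_graph G d" by (simp add: expander_graph_def)
  have fin: "finite I" using regular_graphD(1)[OF reg] by (simp add: I_def)
  have c0: "0 < card I" using fin V by (simp add: I_def card_gt_0_iff)
  have r0: "0 \<le> r" using p q by (simp add: r_def)
  have L: "L2_set (E n f) I \<le> r ^ n * sqrt (card I)"
    using f1 f2
  proof (induction n arbitrary: f)
    case 0
    have "E 0 f = (\<lambda>_. 1)" by (simp add: E_def)
    then show ?case by (simp add: L2_set_def)
  next
    case (Suc n)
    have "L2_set (E (Suc n) f) I
        = L2_set (\<lambda>v. f 0 v * mact I (walk_kernel G d) (E n (\<lambda>i. f (Suc i))) v) I"
      unfolding E_def by (rule L2_set_cong)
        (auto simp del: walk_from.simps prod.lessThan_Suc simp: walk_from_expectation_Suc[OF reg d] I_def)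
    also have "\<dots> \<le> r * L2_set (E n (\<lambda>i. f (Suc i))) I"
      unfolding I_def r_def by (rule expander_step[OF G d q V]) (use Suc.prems p in auto)
    also have "\<dots> \<le> r * (r ^ n * sqrt (card I))"
      using Suc r0 by (intro mult_left_mono) auto
    finally show ?case by simp
  qed
  have "measure_pmf.expectation (random_walk G n) (\<lambda>vs. \<Prod>i<n. f i (vs ! i))
      = (\<Sum>v\<in>I. E n f v /\<^sub>R card I)"
    unfolding random_walk_def E_def I_def
    by (subst pmf_expectation_bind_pmf_of_set)
      (use V fin walk_from_support(1)[OF reg d] in \<open>auto simp: I_def\<close>)
  also have "\<dots> = (\<Sum>v\<in>I. E n f v) / card I"
    by (simp add: sum_distrib_left divide_inverse mult.commute)
  also have "\<dots> \<le> r ^ n"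
  proof -
    \<comment> \<open>Cauchy-Schwarz against the constant 1: the two factors sqrt (card I) cancel
      the weight 1 / card I of the uniform start.\<close>
    have "(\<Sum>v\<in>I. E n f v) \<le> (\<Sum>v\<in>I. \<bar>1 :: real\<bar> * \<bar>E n f v\<bar>)"
      by (rule sum_mono) simp
    also have "\<dots> \<le> L2_set (\<lambda>_. 1) I * L2_set (E n f) I" by (rule L2_set_mult_ineq)
    also have "\<dots> \<le> sqrt (card I) * (r ^ n * sqrt (card I))"
      using L by (intro mult_mono) (auto simp: L2_set_def intro!: sum_nonneg)
    also have "\<dots> = r ^ n * card I" by simp
    finally show ?thesis using c0 by (simp add: divide_le_eq)
  qed
  finally show ?thesis by (simp add: r_def)
qed

section \<open>Averages over independent signs\<close>

definition sign_funs :: "nat \<Rightarrow> (nat \<Rightarrow> real) set" where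
  "sign_funs M = ({..<M} \<rightarrow>\<^sub>E {- 1, 1})"

text \<open>The expectation over \<open>M\<close> independent uniform signs, the reference model for
  limited independence.\<close>

definition sign_avg :: "nat \<Rightarrow> ((nat \<Rightarrow> real) \<Rightarrow> real) \<Rightarrow> real" where
  "sign_avg M F = (\<Sum>u\<in>sign_funs M. F u) / 2 ^ M"

lemma finite_sign_funs [simp]: "finite (sign_funs M)"
  by (simp add: sign_funs_def finite_PiE)

lemma card_sign_funs: "card (sign_funs M) = 2 ^ M"
  by (simp add: sign_funs_def card_PiE numeral_2_eq_2)

lemma sign_avg_mono: "(\<And>u. u \<in> sign_funs M \<Longrightarrow> F u \<le> H u) \<Longrightarrow> sign_avg M F \<le> sign_avg M H"
  by (simp add: sign_avg_def divide_right_mono sum_mono)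

lemma sign_avg_const [simp]: "sign_avg M (\<lambda>_. c) = c"
  by (simp add: sign_avg_def card_sign_funs)

lemma sign_avg_add: "sign_avg M (\<lambda>u. F u + H u) = sign_avg M F + sign_avg M H"
  by (simp add: sign_avg_def sum.distrib add_divide_distrib)

lemma sign_avg_diff: "sign_avg M (\<lambda>u. F u - H u) = sign_avg M F - sign_avg M H"
  by (simp add: sign_avg_def sum_subtractf diff_divide_distrib)

lemma sign_avg_cmult: "sign_avg M (\<lambda>u. c * F u) = c * sign_avg M F"
  by (simp add: sign_avg_def sum_distrib_left)

lemma sign_avg_sum: "sign_avg M (\<lambda>u. \<Sum>i\<in>A. F i u) = (\<Sum>i\<in>A. sign_avg M (F i))"
  unfolding sign_avg_def by (subst sum.swap) (simp add: sum_divide_distrib)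

lemma sign_avg_prod:
  "sign_avg M (\<lambda>u. \<Prod>i<M. h i (u i)) = (\<Prod>i<M. (h i (- 1) + h i 1) / 2)"
proof -
  have "(\<Sum>u\<in>sign_funs M. \<Prod>i<M. h i (u i)) = (\<Prod>i<M. \<Sum>s\<in>{- 1, 1}. h i s)"
    unfolding sign_funs_def by (rule prod_sum_PiE[symmetric]) auto
  also have "\<dots> = (\<Prod>i<M. h i (- 1) + h i 1)" by simp
  finally show ?thesis by (simp add: sign_avg_def prod_dividef)
qed

lemma sign_avg_monomial:
  assumes "S \<subseteq> {..<M}"
  shows "sign_avg M (\<lambda>u. \<Prod>m\<in>S. u m) = (if S = {} then 1 else 0)"
proof -
  have fS: "finite S" using assms finite_subset by blast
  have "sign_avg M (\<lambda>u. \<Prod>m\<in>S. u m) = sign_avg M (\<lambda>u. \<Prod>m<M. if m \<in> S then u m else 1)"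
    using assms by (simp add: prod.If_cases Int_absorb1)
  also have "\<dots> = (\<Prod>m<M. if m \<in> S then 0 else 1)"
    by (subst sign_avg_prod[of M "\<lambda>m s. if m \<in> S then s else 1"]) (auto intro!: prod.cong)
  also have "\<dots> = (if S = {} then 1 else 0)"
    using assms by (auto simp: prod.If_cases Int_absorb1 power_0_left fS)
  finally show ?thesis .
qed

text \<open>Termwise comparison of the power series, since 2^n n! \<le> (2n)!.\<close>

lemma cosh_le_exp_half_square: "(exp (- x) + exp x) / 2 \<le> exp (x\<^sup>2 / 2)" for x :: real
proof -
  have c: "(\<lambda>n. if even n then x ^ n / fact n else 0) sums cosh x"
    using cosh_converges[of x] by (simp add: scaleR_conv_of_real divide_inverse mult.commute cong: if_cong)
  have z: "(if even n then x ^ n / fact n else 0) = 0" if "n \<notin> range (\<lambda>n::nat. 2 * n)" for n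
    using that by (auto elim!: evenE)
  have sm: "strict_mono (\<lambda>n::nat. 2 * n)" by (simp add: strict_mono_def)
  define f where "f = (\<lambda>n. if even n then x ^ n / fact n else 0)"
  have iff: "(\<lambda>n. f (2 * n)) sums cosh x \<longleftrightarrow> f sums cosh x"
    by (rule sums_mono_reindex[OF sm]) (unfold f_def, rule z)
  have f2: "f (2 * n) = x ^ (2 * n) / fact (2 * n)" for n
    unfolding f_def by (simp only: dvd_triv_left if_True)
  have c2: "(\<lambda>n. x ^ (2 * n) / fact (2 * n)) sums cosh x"
    using iffD2[OF iff c[folded f_def]] unfolding f2 .
  have e: "(\<lambda>n. (x\<^sup>2 / 2) ^ n / fact n) sums exp (x\<^sup>2 / 2)"
    using exp_converges[of "x\<^sup>2 / 2"] by (simp only: real_scaleR_def divide_inverse mult.commute)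
  have f: "2 ^ n * fact n \<le> (fact (2 * n) :: real)" for n
  proof (induction n)
    case (Suc n)
    have "2 ^ Suc n * fact (Suc n) = (2 * real (Suc n)) * (2 ^ n * fact n :: real)" by simp
    also have "\<dots> \<le> (real (2 * n + 2) * real (2 * n + 1)) * fact (2 * n)"
      using Suc by (intro mult_mono) (auto simp: algebra_simps)
    also have "\<dots> = fact (2 * Suc n)" by (simp add: algebra_simps)
    finally show ?case .
  qed simp
  have "cosh x \<le> exp (x\<^sup>2 / 2)"
  proof (rule sums_le[OF _ c2 e])
    fix n
    show "x ^ (2 * n) / fact (2 * n) \<le> (x\<^sup>2 / 2) ^ n / fact n"
      using f[of n] by (simp add: power_mult power_divide frac_le)
  qed
  then show ?thesis by (simp add: cosh_def add.commute)
qed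

lemma sign_avg_exp_linear:
  "sign_avg M (\<lambda>u. exp (\<Sum>i<M. y i * u i)) \<le> exp ((\<Sum>i<M. (y i)\<^sup>2) / 2)"
proof -
  have "sign_avg M (\<lambda>u. exp (\<Sum>i<M. y i * u i)) = (\<Prod>i<M. (exp (- y i) + exp (y i)) / 2)"
    by (subst exp_sum) (simp_all add: sign_avg_prod[of M "\<lambda>i s. exp (y i * s)"])
  also have "\<dots> \<le> (\<Prod>i<M. exp ((y i)\<^sup>2 / 2))"
    by (intro prod_mono conjI cosh_le_exp_half_square) simp
  also have "\<dots> = exp ((\<Sum>i<M. (y i)\<^sup>2) / 2)" by (simp add: exp_sum sum_divide_distrib)
  finally show ?thesis .
qed

lemma sign_avg_square_linear: "sign_avg M (\<lambda>u. (\<Sum>i<M. y i * u i)\<^sup>2) = (\<Sum>i<M. (y i)\<^sup>2)"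
proof -
  have one: "sign_avg M (\<lambda>u. u i * u j) = (if i = j then 1 else 0)" if "i < M" "j < M" for i j
  proof (cases "i = j")
    case True
    have "sign_avg M (\<lambda>u. u j * u j) = sign_avg M (\<lambda>_. 1)"
      unfolding sign_avg_def using that by (intro arg_cong2[of _ _ _ _ "(/)"] sum.cong)
        (auto simp: sign_funs_def PiE_def Pi_def)
    then show ?thesis using True by simp
  next
    case False
    then show ?thesis using sign_avg_monomial[of "{i, j}" M] that by simp
  qed
  have "sign_avg M (\<lambda>u. (\<Sum>i<M. y i * u i)\<^sup>2)
      = sign_avg M (\<lambda>u. \<Sum>i<M. \<Sum>j<M. (y i * y j) * (u i * u j))"
    by (simp add: power2_eq_square sum_product mult_ac)
  also have "\<dots> = (\<Sum>i<M. \<Sum>j<M. y i * y j * (if i = j then 1 else 0))"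
    by (simp add: sign_avg_sum sign_avg_cmult one)
  also have "\<dots> = (\<Sum>i<M. (y i)\<^sup>2)"
    by (simp add: power2_eq_square if_distrib[of "\<lambda>x. _ * x"] cong: if_cong)
  finally show ?thesis .
qed

text \<open>All terms of the cosh series are nonnegative; keep those of order 0, 2, 4 and solve for
  x^4.\<close>

lemma fourth_power_le_cosh: "x ^ 4 \<le> 12 * (exp x + exp (- x)) - 24 - 12 * x\<^sup>2" for x :: real
proof -
  have c: "(\<lambda>n. if even n then x ^ n / fact n else 0) sums cosh x"
    using cosh_converges[of x] by (simp add: scaleR_conv_of_real divide_inverse mult.commute cong: if_cong)
  have "(\<Sum>n\<in>{0, 2, 4}. if even n then x ^ n / fact n else 0) \<le> cosh x"
    using sum_le_suminf[of "\<lambda>n. if even n then x ^ n / fact n else 0" "{0, 2, 4}"] c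
    by (auto simp: sums_iff zero_le_even_power)
  then show ?thesis
    by (simp add: cosh_def fact_numeral field_simps)
qed

text \<open>Instead of expanding the fourth power, use the exponential moments of \<open>S\<close>
  and \<open>- S\<close> and the exact second moment.\<close>

lemma sign_avg_fourth_linear:
  assumes "(\<Sum>i<M. (y i)\<^sup>2) = 1"
  shows "sign_avg M (\<lambda>u. (\<Sum>i<M. y i * u i) ^ 4) \<le> 18 / 5"
proof -
  \<comment> \<open>The value 33/20 gives 24 * 33/20 - 36 = 18/5 at the end.\<close>
  have e: "exp (1 / 2 :: real) \<le> 33 / 20"
  proof -
    have "(exp (1 / 2 :: real))\<^sup>2 = exp 1" by (simp add: power2_eq_square exp_add[symmetric])
    also have "\<dots> \<le> (33 / 20)\<^sup>2" using e_less_272 by (simp add: power2_eq_square)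
    finally show ?thesis by (rule power2_le_imp_le) simp
  qed
  define S where "S = (\<lambda>u. \<Sum>i<M. y i * u i)"
  have m: "(\<lambda>u. - S u) = (\<lambda>u. \<Sum>i<M. (- y i) * u i)" by (simp add: S_def sum_negf)
  have "sign_avg M (\<lambda>u. S u ^ 4)
      \<le> sign_avg M (\<lambda>u. 12 * (exp (S u) + exp (- S u)) - 24 - 12 * (S u)\<^sup>2)"
    by (intro sign_avg_mono fourth_power_le_cosh)
  also have "\<dots> = 12 * (sign_avg M (\<lambda>u. exp (S u)) + sign_avg M (\<lambda>u. exp (- S u))) - 36"
    by (simp add: sign_avg_diff sign_avg_add sign_avg_cmult) (simp add: S_def sign_avg_square_linear assms)
  also have "\<dots> \<le> 12 * (exp (1 / 2) + exp (1 / 2)) - 36"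
    using sign_avg_exp_linear[of M y] sign_avg_exp_linear[of M "\<lambda>i. - y i"] assms
    by (simp add: S_def sum_negf)
  also have "\<dots> \<le> 18 / 5" using e by simp
  finally show ?thesis by (simp add: S_def)
qed

section \<open>Polynomials of bounded degree in the signs\<close>

text \<open>Each monomial is a coefficient with a list of indices. Repetitions are allowed, so
  degree counts multiplicity and multiplication concatenates lists.\<close>

definition deg_le :: "nat \<Rightarrow> nat \<Rightarrow> ((nat \<Rightarrow> real) \<Rightarrow> real) \<Rightarrow> bool" where
  "deg_le M D F \<longleftrightarrow> (\<exists>L. (\<forall>(c, ms)\<in>set L. length ms \<le> D \<and> set ms \<subseteq> {..<M}) \<and>
     (\<forall>u. F u = (\<Sum>(c, ms)\<leftarrow>L. c * (\<Prod>m\<leftarrow>ms. u m))))"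

lemma deg_le_const: "deg_le M 0 (\<lambda>_. c)"
  unfolding deg_le_def by (intro exI[of _ "[(c, [])]"]) auto

lemma deg_le_var: "m < M \<Longrightarrow> deg_le M 1 (\<lambda>u. u m)"
  unfolding deg_le_def by (intro exI[of _ "[(1, [m])]"]) auto

lemma deg_le_mono: "deg_le M D F \<Longrightarrow> D \<le> D' \<Longrightarrow> deg_le M D' F"
  unfolding deg_le_def by fastforce

lemma deg_le_add:
  assumes "deg_le M D F" "deg_le M D H" shows "deg_le M D (\<lambda>u. F u + H u)"
proof -
  from assms obtain L L' where "\<forall>(c, ms)\<in>set L. length ms \<le> D \<and> set ms \<subseteq> {..<M}"
    "\<forall>u. F u = (\<Sum>(c, ms)\<leftarrow>L. c * (\<Prod>m\<leftarrow>ms. u m))"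
    "\<forall>(c, ms)\<in>set L'. length ms \<le> D \<and> set ms \<subseteq> {..<M}"
    "\<forall>u. H u = (\<Sum>(c, ms)\<leftarrow>L'. c * (\<Prod>m\<leftarrow>ms. u m))" unfolding deg_le_def by blast
  then show ?thesis unfolding deg_le_def by (intro exI[of _ "L @ L'"]) auto
qed

lemma deg_le_mult:
  assumes "deg_le M D F" "deg_le M D' H" shows "deg_le M (D + D') (\<lambda>u. F u * H u)"
proof -
  from assms obtain L L' where L: "\<forall>(c, ms)\<in>set L. length ms \<le> D \<and> set ms \<subseteq> {..<M}"
    "\<forall>u. F u = (\<Sum>(c, ms)\<leftarrow>L. c * (\<Prod>m\<leftarrow>ms. u m))"
    "\<forall>(c, ms)\<in>set L'. length ms \<le> D' \<and> set ms \<subseteq> {..<M}"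
    "\<forall>u. H u = (\<Sum>(c, ms)\<leftarrow>L'. c * (\<Prod>m\<leftarrow>ms. u m))" unfolding deg_le_def by blast
  define mm where "mm = (\<lambda>((c, ms), (c', ms')). (c * c' :: real, ms @ ms' :: nat list))"
  define LL where "LL = map mm (List.product L L')"
  have "F u * H u = (\<Sum>(c, ms)\<leftarrow>LL. c * (\<Prod>m\<leftarrow>ms. u m))" for u
  proof -
    have "(\<Sum>p\<leftarrow>L. (case p of (c, ms) \<Rightarrow> c * (\<Prod>m\<leftarrow>ms. u m))) * (\<Sum>p\<leftarrow>L'. (case p of (c, ms) \<Rightarrow> c * (\<Prod>m\<leftarrow>ms. u m)))
      = (\<Sum>p\<leftarrow>map mm (List.product L L'). (case p of (c, ms) \<Rightarrow> c * (\<Prod>m\<leftarrow>ms. u m)))"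
    proof (induction L)
      case (Cons a L)
      have "(\<Sum>p\<leftarrow>map mm (map (Pair a) L'). (case p of (c, ms) \<Rightarrow> c * (\<Prod>m\<leftarrow>ms. u m)))
        = (case a of (c, ms) \<Rightarrow> c * (\<Prod>m\<leftarrow>ms. u m)) * (\<Sum>p\<leftarrow>L'. (case p of (c, ms) \<Rightarrow> c * (\<Prod>m\<leftarrow>ms. u m)))"
        by (induction L') (auto simp: mm_def distrib_left split: prod.splits)
      then show ?case using Cons by (simp add: distrib_right)
    qed simp
    then show ?thesis using L by (simp add: LL_def)
  qed
  moreover have "\<forall>(c, ms)\<in>set LL. length ms \<le> D + D' \<and> set ms \<subseteq> {..<M}"
    using L(1,3) by (fastforce simp: LL_def mm_def)
  ultimately show ?thesis unfolding deg_le_def by blast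
qed

lemma deg_le_cmult: "deg_le M D F \<Longrightarrow> deg_le M D (\<lambda>u. c * F u)"
  using deg_le_mult[OF deg_le_const] by simp

lemma deg_le_power: "deg_le M D F \<Longrightarrow> deg_le M (n * D) (\<lambda>u. F u ^ n)"
  by (induction n) (use deg_le_const deg_le_mult in auto)

lemma deg_le_sum:
  assumes "\<And>i. i \<in> A \<Longrightarrow> deg_le M D (F i)" shows "deg_le M D (\<lambda>u. \<Sum>i\<in>A. F i u)"
  using assms
proof (induction A rule: infinite_finite_induct)
  case (insert x A)
  then show ?case by (simp add: deg_le_add)
qed (use deg_le_mono[OF deg_le_const] in auto)

text \<open>Signs square to 1, so equal factors cancel in pairs; \<open>S\<close> collects the
  indices of odd multiplicity.\<close>

lemma sign_monomial_reduce:
  "\<exists>S \<subseteq> set ms. card S \<le> length ms \<and>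
    (\<forall>u :: nat \<Rightarrow> real. (\<forall>m\<in>set ms. u m \<in> {- 1, 1}) \<longrightarrow> (\<Prod>m\<leftarrow>ms. u m) = (\<Prod>m\<in>S. u m))"
proof (induction ms)
  case (Cons a ms)
  then obtain S where S: "S \<subseteq> set ms" "card S \<le> length ms"
    "\<And>u :: nat \<Rightarrow> real. (\<forall>m\<in>set ms. u m \<in> {- 1, 1}) \<Longrightarrow> (\<Prod>m\<leftarrow>ms. u m) = (\<Prod>m\<in>S. u m)" by blast
  have fS: "finite S" using S(1) finite_subset by blast
  show ?case
  proof (cases "a \<in> S")
    case True
    have "(\<Prod>m\<leftarrow>a # ms. u m) = (\<Prod>m\<in>S - {a}. u m)" if u: "\<forall>m\<in>set (a # ms). u m \<in> {- 1, 1 :: real}" for u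
    proof -
      have "(\<Prod>m\<in>S. u m) = u a * (\<Prod>m\<in>S - {a}. u m)" using True fS by (rule prod.remove[rotated])
      moreover have "u a * u a = 1" using u by auto
      ultimately show ?thesis using S(3)[of u] u by (simp add: mult.assoc[symmetric])
    qed
    moreover have "card (S - {a}) \<le> length (a # ms)" using S(2) fS by (simp add: card_Diff1_le le_SucI card_Diff_singleton_if)
    ultimately show ?thesis using S(1) by (intro exI[of _ "S - {a}"]) auto
  next
    case False
    then show ?thesis using S fS by (intro exI[of _ "insert a S"]) auto
  qed
qed auto

lemma kwise_monomial_expectation:
  assumes fin: "finite (set_pmf p)" and k: "kwise_random_signs (measure_pmf p) k M X" and kM: "k \<le> M"
    and sgn: "\<And>m \<omega>. m < M \<Longrightarrow> \<omega> \<in> set_pmf p \<Longrightarrow> X m \<omega> \<in> {- 1, 1}"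
    and S: "S \<subseteq> {..<M}" "card S \<le> k"
  shows "measure_pmf.expectation p (\<lambda>\<omega>. \<Prod>m\<in>S. X m \<omega>) = (if S = {} then 1 else 0)"
proof (cases "S = {}")
  case False
  have fS: "finite S" using S(1) finite_subset by blast
  \<comment> \<open>\<open>kwise_random_signs\<close> speaks of sets of exactly \<open>k\<close>
    indices, so \<open>S\<close> is first enlarged, which is possible because
    \<open>k \<le> M\<close>.\<close>
  obtain I where I: "S \<subseteq> I" "I \<subseteq> {..<M}" "card I = k"
    using exists_subset_between[OF S(2) _ S(1)] kM by auto
  have "prob_space.indep_vars (measure_pmf p) (\<lambda>_. borel) X I"
    using k I by (simp add: kwise_random_signs_def)
  then have ind: "prob_space.indep_vars (measure_pmf p) (\<lambda>_. borel) X S"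
    by (rule prob_space.indep_vars_subset[OF prob_space_measure_pmf _ I(1)])
  have zero: "measure_pmf.expectation p (X m) = 0" if m: "m < M" for m
  proof -
    have "measure_pmf.expectation p (X m)
      = measure_pmf.expectation p (\<lambda>\<omega>. indicat_real {\<omega>. X m \<omega> = 1} \<omega> - indicat_real {\<omega>. X m \<omega> = - 1} \<omega>)"
      by (intro integral_cong_AE) (auto simp: AE_measure_pmf_iff indicator_def dest!: sgn[OF m])
    also have "\<dots> = measure_pmf.prob p {\<omega>. X m \<omega> = 1} - measure_pmf.prob p {\<omega>. X m \<omega> = - 1}"
      by (subst Bochner_Integration.integral_diff) (auto intro!: integrable_measure_pmf_finite fin)
    also have "\<dots> = 0"
    proof -
      have "measure_pmf.prob p {\<omega>. X m \<omega> = 1} = 1 / 2" "measure_pmf.prob p {\<omega>. X m \<omega> = - 1} = 1 / 2"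
        using k m unfolding kwise_random_signs_def by auto
      then show ?thesis by simp
    qed
    finally show ?thesis .
  qed
  have "measure_pmf.expectation p (\<lambda>\<omega>. \<Prod>m\<in>S. X m \<omega>) = (\<Prod>m\<in>S. measure_pmf.expectation p (X m))"
    by (rule prob_space.indep_vars_lebesgue_integral[OF prob_space_measure_pmf fS ind])
      (auto intro!: integrable_measure_pmf_finite fin)
  also have "\<dots> = 0" using False S(1) zero fS by (auto simp: subset_eq intro!: prod_zero)
  finally show ?thesis using False by simp
qed simp

text \<open>By linearity it suffices to treat monomials; reduced to products over at most
  \<open>k\<close> distinct signs, they have the same mean under both laws.\<close>

lemma kwise_expectation_deg_le:
  assumes fin: "finite (set_pmf p)" and k: "kwise_random_signs (measure_pmf p) k M X" and kM: "k \<le> M"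
    and sgn: "\<And>m \<omega>. m < M \<Longrightarrow> \<omega> \<in> set_pmf p \<Longrightarrow> X m \<omega> \<in> {- 1, 1}"
    and F: "deg_le M D F" and D: "D \<le> k"
  shows "measure_pmf.expectation p (\<lambda>\<omega>. F (\<lambda>m. X m \<omega>)) = sign_avg M F"
proof -
  from F obtain L where L: "\<forall>(c, ms)\<in>set L. length ms \<le> D \<and> set ms \<subseteq> {..<M}"
    and FL: "\<And>u. F u = (\<Sum>(c, ms)\<leftarrow>L. c * (\<Prod>m\<leftarrow>ms. u m))" unfolding deg_le_def by blast
  have mono: "measure_pmf.expectation p (\<lambda>\<omega>. \<Prod>m\<leftarrow>ms. X m \<omega>) = sign_avg M (\<lambda>u. \<Prod>m\<leftarrow>ms. u m)"
    if ms: "length ms \<le> D" "set ms \<subseteq> {..<M}" for ms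
  proof -
    obtain S where S: "S \<subseteq> set ms" "card S \<le> length ms"
      "\<And>u :: nat \<Rightarrow> real. (\<forall>m\<in>set ms. u m \<in> {- 1, 1}) \<Longrightarrow> (\<Prod>m\<leftarrow>ms. u m) = (\<Prod>m\<in>S. u m)"
      using sign_monomial_reduce[of ms] by blast
    have SM: "S \<subseteq> {..<M}" "card S \<le> k" using S(1,2) ms D by auto
    have "measure_pmf.expectation p (\<lambda>\<omega>. \<Prod>m\<leftarrow>ms. X m \<omega>)
        = measure_pmf.expectation p (\<lambda>\<omega>. \<Prod>m\<in>S. X m \<omega>)"
    proof (intro integral_cong_AE)
      show "AE \<omega> in measure_pmf p. (\<Prod>m\<leftarrow>ms. X m \<omega>) = (\<Prod>m\<in>S. X m \<omega>)"
        unfolding AE_measure_pmf_iff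
      proof
        fix \<omega> assume "\<omega> \<in> set_pmf p"
        then show "(\<Prod>m\<leftarrow>ms. X m \<omega>) = (\<Prod>m\<in>S. X m \<omega>)"
          using sgn ms(2) by (intro S(3)[of "\<lambda>m. X m \<omega>"]) blast
      qed
    qed auto
    also have "\<dots> = sign_avg M (\<lambda>u. \<Prod>m\<in>S. u m)"
      using kwise_monomial_expectation[OF fin k kM sgn SM] sign_avg_monomial[OF SM(1)] by simp
    also have "\<dots> = sign_avg M (\<lambda>u. \<Prod>m\<leftarrow>ms. u m)"
      unfolding sign_avg_def
    proof (intro arg_cong2[of _ _ _ _ "(/)"] sum.cong refl)
      fix u assume "u \<in> sign_funs M"
      then show "(\<Prod>m\<in>S. u m) = (\<Prod>m\<leftarrow>ms. u m)"
        using ms(2) by (intro S(3)[symmetric]) (auto simp: sign_funs_def PiE_def Pi_def)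
    qed
    finally show ?thesis .
  qed
  have "measure_pmf.expectation p (\<lambda>\<omega>. \<Sum>(c, ms)\<leftarrow>L. c * (\<Prod>m\<leftarrow>ms. X m \<omega>))
      = sign_avg M (\<lambda>u. \<Sum>(c, ms)\<leftarrow>L. c * (\<Prod>m\<leftarrow>ms. u m))"
    using L
  proof (induction L)
    case (Cons a L)
    obtain c ms where a: "a = (c, ms)" by force
    show ?case using Cons mono[of ms] fin
      by (simp add: a sign_avg_add sign_avg_cmult integrable_measure_pmf_finite)
  qed simp
  moreover have "F = (\<lambda>u. \<Sum>(c, ms)\<leftarrow>L. c * (\<Prod>m\<leftarrow>ms. u m))" using FL by auto
  ultimately show ?thesis by simp
qed

section \<open>Lattice nets\<close>

text \<open>\<open>extensional\<close> fixes the values outside the first \<open>N\<close> indices,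
  so that each integer vector is represented by one function.\<close>

definition lattice_ball :: "nat \<Rightarrow> real \<Rightarrow> (nat \<Rightarrow> int) set" where
  "lattice_ball N s = {m \<in> extensional {..<N}. (\<Sum>i<N. \<bar>real_of_int (m i)\<bar>) \<le> s}"

lemma sum_geometric_symmetric:
  fixes r :: real
  assumes "0 < r" "r < 1"
  shows "(\<Sum>b\<in>{- int B..int B}. r ^ nat \<bar>b\<bar>) = 1 + 2 * r / (1 - r) - 2 * r ^ Suc B / (1 - r)"
proof (induction B)
  case (Suc B)
  have "{- int (Suc B)..int (Suc B)} = insert (- int (Suc B)) (insert (int (Suc B)) {- int B..int B})"
    by auto
  then have "(\<Sum>b\<in>{- int (Suc B)..int (Suc B)}. r ^ nat \<bar>b\<bar>)
      = 2 * r ^ Suc B + (\<Sum>b\<in>{- int B..int B}. r ^ nat \<bar>b\<bar>)"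
    by (simp add: nat_add_distrib)
  moreover have "2 * r ^ Suc B = 2 * r ^ Suc B / (1 - r) - 2 * r ^ Suc (Suc B) / (1 - r)"
    using assms unfolding diff_divide_distrib[symmetric]
    by (subst eq_divide_eq) (simp add: algebra_simps)
  ultimately show ?case using Suc by linarith
qed (use assms in simp)

text \<open>The weight exp (c (s - |m|_1)) is at least 1 on the ball; summed over a product box it
  splits into one geometric series per coordinate.\<close>

lemma lattice_ball_card:
  assumes c: "0 < c"
  shows "finite (lattice_ball N s)"
    "real (card (lattice_ball N s)) \<le> exp (c * s + 2 * real N / (exp c - 1))"
proof -
  define B where "B = nat \<lfloor>s\<rfloor>"
  define X where "X = ({..<N} \<rightarrow>\<^sub>E {- int B..int B})"
  have fX: "finite X" by (auto simp: X_def intro: finite_PiE)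
  have sub: "lattice_ball N s \<subseteq> X"
  proof
    fix m assume m: "m \<in> lattice_ball N s"
    have "m i \<in> {- int B..int B}" if "i < N" for i
    proof -
      have "\<bar>real_of_int (m i)\<bar> \<le> (\<Sum>i<N. \<bar>real_of_int (m i)\<bar>)"
        using that by (intro member_le_sum) auto
      also have "\<dots> \<le> s" using m by (simp add: lattice_ball_def)
      finally have "\<bar>m i\<bar> \<le> \<lfloor>s\<rfloor>" by (simp add: le_floor_iff)
      moreover from this have "0 \<le> \<lfloor>s\<rfloor>" by linarith
      ultimately show ?thesis by (auto simp: B_def)
    qed
    then show "m \<in> X" using m by (auto simp: X_def lattice_ball_def PiE_def)
  qed
  show fin: "finite (lattice_ball N s)" using sub fX by (rule finite_subset)
  define r where "r = exp (- c)"
  have r: "0 < r" "r < 1" using c by (auto simp: r_def)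
  have "(\<Sum>b\<in>{- int B..int B}. exp (- c * \<bar>real_of_int b\<bar>)) = (\<Sum>b\<in>{- int B..int B}. r ^ nat \<bar>b\<bar>)"
    by (rule sum.cong) (auto simp: r_def exp_of_nat_mult[symmetric] mult.commute)
  also have "\<dots> \<le> 1 + 2 * r / (1 - r)" using r by (simp add: sum_geometric_symmetric)
  also have "\<dots> = 1 + 2 / (exp c - 1)"
    using c by (simp add: r_def exp_minus field_simps)
  also have "\<dots> \<le> exp (2 / (exp c - 1))" by (rule exp_ge_add_one_self)
  finally have one: "(\<Sum>b\<in>{- int B..int B}. exp (- c * \<bar>real_of_int b\<bar>)) \<le> exp (2 / (exp c - 1))" .
  have "real (card (lattice_ball N s)) = (\<Sum>m\<in>lattice_ball N s. 1)" by simp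
  also have "\<dots> \<le> (\<Sum>m\<in>lattice_ball N s. exp (c * s) * (\<Prod>i<N. exp (- c * \<bar>real_of_int (m i)\<bar>)))"
  proof (intro sum_mono)
    fix m assume "m \<in> lattice_ball N s"
    then have "c * (\<Sum>i<N. \<bar>real_of_int (m i)\<bar>) \<le> c * s" using c by (simp add: lattice_ball_def)
    then show "1 \<le> exp (c * s) * (\<Prod>i<N. exp (- c * \<bar>real_of_int (m i)\<bar>))"
      by (simp add: exp_sum[symmetric] exp_add[symmetric] sum_distrib_left sum_negf)
  qed
  also have "\<dots> \<le> (\<Sum>m\<in>X. exp (c * s) * (\<Prod>i<N. exp (- c * \<bar>real_of_int (m i)\<bar>)))"
    by (intro sum_mono2 fX sub) (auto intro!: mult_nonneg_nonneg prod_nonneg)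
  also have "\<dots> = exp (c * s) * (\<Prod>i<N. \<Sum>b\<in>{- int B..int B}. exp (- c * \<bar>real_of_int b\<bar>))"
    unfolding X_def sum_distrib_left[symmetric] by (subst prod_sum_PiE) auto
  also have "\<dots> \<le> exp (c * s) * (\<Prod>i<N. exp (2 / (exp c - 1)))"
    using one by (intro mult_left_mono prod_mono) (auto intro!: sum_nonneg)
  also have "\<dots> = exp (c * s + 2 * real N / (exp c - 1))"
    by (simp add: exp_add exp_of_nat_mult[symmetric] mult.commute)
  finally show "real (card (lattice_ball N s)) \<le> exp (c * s + 2 * real N / (exp c - 1))" .
qed

section \<open>Rounding to lattices and the resulting nets\<close>

definition round0 :: "real \<Rightarrow> int" where
  "round0 x = (if 0 \<le> x then \<lfloor>x\<rfloor> else - \<lfloor>- x\<rfloor>)"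

lemma round0:
  "\<bar>real_of_int (round0 x)\<bar> \<le> \<bar>x\<bar>" "\<bar>x - real_of_int (round0 x)\<bar> \<le> 1"
  "\<bar>x - real_of_int (round0 x)\<bar> \<le> \<bar>x\<bar>"
proof -
  have f: "0 \<le> real_of_int \<lfloor>y\<rfloor>" "real_of_int \<lfloor>y\<rfloor> \<le> y" "y \<le> real_of_int \<lfloor>y\<rfloor> + 1" if "0 \<le> y" for y :: real
    using that by (simp_all add: real_of_int_floor_add_one_ge)
  have "\<bar>real_of_int (round0 x)\<bar> \<le> \<bar>x\<bar> \<and> \<bar>x - real_of_int (round0 x)\<bar> \<le> 1
    \<and> \<bar>x - real_of_int (round0 x)\<bar> \<le> \<bar>x\<bar>"
  proof (cases "0 \<le> x")
    case True
    have "real_of_int (round0 x) = real_of_int \<lfloor>x\<rfloor>" using True by (simp only: round0_def if_True)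
    then show ?thesis using f[OF True] True by linarith
  next
    case False
    have "real_of_int (round0 x) = - real_of_int \<lfloor>- x\<rfloor>"
      using False by (simp only: round0_def if_False of_int_minus)
    moreover have "0 \<le> - x" using False by linarith
    ultimately show ?thesis using f[of "- x"] False by linarith
  qed
  then show "\<bar>real_of_int (round0 x)\<bar> \<le> \<bar>x\<bar>" "\<bar>x - real_of_int (round0 x)\<bar> \<le> 1"
    "\<bar>x - real_of_int (round0 x)\<bar> \<le> \<bar>x\<bar>" by blast+
qed

lemma round0_scaled:
  assumes t: "0 < t"
  shows "\<bar>t * real_of_int (round0 (x / t))\<bar> \<le> \<bar>x\<bar>"
    "\<bar>x - t * real_of_int (round0 (x / t))\<bar> \<le> t"
    "\<bar>x - t * real_of_int (round0 (x / t))\<bar> \<le> \<bar>x\<bar>"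
proof -
  have e: "x - t * real_of_int (round0 (x / t)) = t * (x / t - real_of_int (round0 (x / t)))"
    using t by (simp add: right_diff_distrib)
  have x: "\<bar>x\<bar> = t * \<bar>x / t\<bar>" using t by (simp add: abs_mult[symmetric])
  show "\<bar>t * real_of_int (round0 (x / t))\<bar> \<le> \<bar>x\<bar>"
    unfolding x abs_mult using t round0(1)[of "x / t"] by (simp add: mult_left_mono del: abs_divide)
  show "\<bar>x - t * real_of_int (round0 (x / t))\<bar> \<le> t"
    unfolding e abs_mult using t round0(2)[of "x / t"] by (simp add: mult_left_le)
  show "\<bar>x - t * real_of_int (round0 (x / t))\<bar> \<le> \<bar>x\<bar>"
    unfolding e x abs_mult using t round0(3)[of "x / t"] by (simp add: mult_left_mono del: abs_divide)
qed

text \<open>Rounding towards 0 does not increase the l1 norm. The error in a coordinate is at most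
  both \<open>t\<close> and |x_i|, so its square is at most t |x_i|.\<close>

lemma l1_net:
  fixes x :: "nat \<Rightarrow> real"
  assumes t: "0 < t" and x: "(\<Sum>i<N. \<bar>x i\<bar>) \<le> a"
  obtains m where "m \<in> lattice_ball N (a / t)"
    "sqn {..<N} (\<lambda>i. x i - t * real_of_int (m i)) \<le> t * a"
proof -
  define m where "m = (\<lambda>i\<in>{..<N}. round0 (x i / t))"
  have "(\<Sum>i<N. \<bar>real_of_int (m i)\<bar>) \<le> (\<Sum>i<N. \<bar>x i\<bar> / t)"
    using t by (intro sum_mono) (auto simp: m_def intro!: order_trans[OF round0(1)])
  also have "\<dots> \<le> a / t" using x t by (simp add: sum_divide_distrib[symmetric] divide_right_mono)
  finally have 1: "m \<in> lattice_ball N (a / t)" by (simp add: lattice_ball_def m_def)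
  have "sqn {..<N} (\<lambda>i. x i - t * real_of_int (m i)) \<le> (\<Sum>i<N. t * \<bar>x i\<bar>)"
    unfolding sqn_def
  proof (intro sum_mono)
    fix i assume "i \<in> {..<N}"
    then show "(x i - t * real_of_int (m i))\<^sup>2 \<le> t * \<bar>x i\<bar>"
      using mult_mono[OF round0_scaled(2)[OF t, of "x i"] round0_scaled(3)[OF t, of "x i"]] t
      by (simp add: m_def abs_mult[symmetric] power2_eq_square)
  qed
  also have "\<dots> \<le> t * a" using t x by (simp add: sum_distrib_left[symmetric])
  finally show thesis using that 1 by blast
qed

text \<open>The mesh 1 / (4 sqrt N) keeps the rounding error at most 1/4 in l2 norm;
  \<open>16 * real N\<close> is the inverse square of the mesh.\<close>

definition l2_net :: "nat \<Rightarrow> (nat \<Rightarrow> real) set" where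
  "l2_net N = {q \<in> (\<lambda>m i. real_of_int (m i) / (4 * sqrt (real N))) ` lattice_ball N (16 * real N).
     sqn {..<N} q \<le> 1}"

lemma l2_net_card:
  "finite (l2_net N)" "real (card (l2_net N)) \<le> exp (18 * real N)"
proof -
  note L = lattice_ball_card[of 1 N "16 * real N"]
  have f: "finite ((\<lambda>m i. real_of_int (m i) / (4 * sqrt (real N))) ` lattice_ball N (16 * real N))"
    using L(1) by simp
  show "finite (l2_net N)" unfolding l2_net_def using f by simp
  have "card (l2_net N) \<le> card (lattice_ball N (16 * real N))"
    unfolding l2_net_def using f L(1) by (intro order_trans[OF card_mono card_image_le]) auto
  then have "real (card (l2_net N)) \<le> exp (1 * (16 * real N) + 2 * real N / (exp 1 - 1))"
    using L(2) by simp
  also have "\<dots> \<le> exp (18 * real N)"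
  proof -
    have "2 * real N / (exp 1 - 1) \<le> 2 * real N / 1"
      using exp_ge_add_one_self[of "1 :: real"] by (intro divide_left_mono) auto
    then show ?thesis by simp
  qed
  finally show "real (card (l2_net N)) \<le> exp (18 * real N)" .
qed

lemma l2_net:
  assumes N: "0 < N" and x: "sqn {..<N} x \<le> 1"
  obtains q where "q \<in> l2_net N" "sqn {..<N} (\<lambda>i. x i - q i) \<le> 1 / 16"
proof -
  define t where "t = 1 / (4 * sqrt (real N))"
  have t: "0 < t" and t2: "t\<^sup>2 = 1 / (16 * real N)"
    using N by (auto simp: t_def power_divide power_mult_distrib)
  define m where "m = (\<lambda>i\<in>{..<N}. round0 (x i / t))"
  define q where "q = (\<lambda>i. real_of_int (m i) / (4 * sqrt (real N)))"
  have q: "q i = t * real_of_int (m i)" for i by (simp add: q_def t_def)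
  have q1: "sqn {..<N} q \<le> sqn {..<N} x"
    unfolding sqn_def using round0_scaled(1)[OF t]
    by (intro sum_mono) (auto simp: q m_def abs_le_square_iff[symmetric])
  \<comment> \<open>An integer is at most its square in absolute value, so the l1 norm of
    \<open>m\<close> is controlled by its squared l2 norm.\<close>
  have "(\<Sum>i<N. \<bar>real_of_int (m i)\<bar>) \<le> (\<Sum>i<N. (real_of_int (m i))\<^sup>2)"
  proof (intro sum_mono)
    fix i
    have "\<bar>m i\<bar> \<le> \<bar>m i\<bar> * \<bar>m i\<bar>" 
      using mult_left_mono[of 1 "\<bar>m i\<bar>" "\<bar>m i\<bar>"] by (cases "m i = 0") auto
    then have "\<bar>m i\<bar> \<le> (m i)\<^sup>2" by (simp add: power2_eq_square abs_mult[symmetric])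
    then show "\<bar>real_of_int (m i)\<bar> \<le> (real_of_int (m i))\<^sup>2"
      by (metis of_int_abs of_int_le_iff of_int_power)
  qed
  also have "\<dots> = sqn {..<N} q / t\<^sup>2"
    using t by (simp add: sqn_def q power_mult_distrib sum_distrib_left[symmetric])
  also have "\<dots> \<le> 1 / t\<^sup>2" using q1 x by (intro divide_right_mono) auto
  finally have "m \<in> lattice_ball N (16 * real N)"
    using N by (simp add: lattice_ball_def m_def t2)
  then have "q \<in> l2_net N" using q1 x unfolding l2_net_def q_def by auto
  moreover have "sqn {..<N} (\<lambda>i. x i - q i) \<le> (\<Sum>i<N. t\<^sup>2)"
    unfolding sqn_def using round0_scaled(2)[OF t] t
    by (intro sum_mono) (auto simp: q m_def abs_le_square_iff[symmetric])
  ultimately show thesis using that N by (simp add: t2)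
qed

section \<open>The operator norm\<close>

definition bil :: "nat \<Rightarrow> nat \<Rightarrow> (nat \<Rightarrow> nat \<Rightarrow> real) \<Rightarrow> (nat \<Rightarrow> real) \<Rightarrow> (nat \<Rightarrow> real) \<Rightarrow> real" where
  "bil n N A y x = (\<Sum>i<n. y i * mact {..<N} A x i)"

text \<open>The Euclidean operator norm, in the bilinear form that allows both arguments to be
  discretised.\<close>

definition opn :: "nat \<Rightarrow> nat \<Rightarrow> (nat \<Rightarrow> nat \<Rightarrow> real) \<Rightarrow> real" where
  "opn n N A = Sup {bil n N A y x | y x. sqn {..<n} y \<le> 1 \<and> sqn {..<N} x \<le> 1}"

lemma sqn_cmult: "sqn I (\<lambda>i. c * x i) = c\<^sup>2 * sqn I x"
  by (simp add: sqn_def power_mult_distrib sum_distrib_left)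

lemma bil_sum_sum: "bil n N A y x = (\<Sum>i<n. \<Sum>j<N. y i * x j * A i j)"
  by (simp add: bil_def mact_def sum_distrib_left mult_ac)

lemma bil_cmult:
  "bil n N A (\<lambda>i. a * y i) x = a * bil n N A y x"
  "bil n N A y (\<lambda>i. a * x i) = a * bil n N A y x"
  by (simp_all add: bil_sum_sum sum_distrib_left mult_ac)

lemma bil_le_opn1:
  assumes "sqn {..<n} y \<le> 1" "sqn {..<N} x \<le> 1" shows "bil n N A y x \<le> opn n N A"
  unfolding opn_def
proof (rule cSup_upper)
  show "bdd_above {bil n N A y x | y x. sqn {..<n} y \<le> 1 \<and> sqn {..<N} x \<le> 1}"
  proof (rule bdd_aboveI[of _ "\<Sum>i<n. \<Sum>j<N. \<bar>A i j\<bar>"], safe)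
    fix y x assume y: "sqn {..<n} y \<le> 1" and x: "sqn {..<N} x \<le> 1"
    have le1: "\<bar>z i\<bar> \<le> 1" if "sqn {..<k} z \<le> 1" "i < k" for z :: "nat \<Rightarrow> real" and i k
      using member_le_sum[of i "{..<k}" "\<lambda>i. (z i)\<^sup>2"] that
      by (auto simp: sqn_def abs_square_le_1[symmetric])
    have "bil n N A y x \<le> (\<Sum>i<n. \<Sum>j<N. \<bar>y i * x j * A i j\<bar>)"
      unfolding bil_sum_sum by (intro sum_mono) simp
    also have "\<dots> \<le> (\<Sum>i<n. \<Sum>j<N. \<bar>A i j\<bar>)"
    proof (intro sum_mono)
      fix i j assume "i \<in> {..<n}" "j \<in> {..<N}"
      then have "\<bar>y i\<bar> * \<bar>x j\<bar> \<le> 1" using le1[OF y] le1[OF x] by (simp add: mult_le_one)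
      then show "\<bar>y i * x j * A i j\<bar> \<le> \<bar>A i j\<bar>"
        by (simp add: abs_mult mult_left_le_one_le)
    qed
    finally show "bil n N A y x \<le> (\<Sum>i<n. \<Sum>j<N. \<bar>A i j\<bar>)" .
  qed
qed (use assms in blast)

lemma opn_nonneg: "0 \<le> opn n N A"
  using bil_le_opn1[of n "\<lambda>_. 0" N "\<lambda>_. 0" A] by (simp add: sqn_def bil_def)

lemma bil_le_opn: "bil n N A y x \<le> opn n N A * sqrt (sqn {..<n} y) * sqrt (sqn {..<N} x)"
proof (cases "sqn {..<n} y = 0 \<or> sqn {..<N} x = 0")
  case True
  then have "bil n N A y x = 0"
    by (auto simp: sqn_def sum_nonneg_eq_0_iff bil_def mact_def)
  then show ?thesis using opn_nonneg by simp
next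
  case False
  define a where "a = sqrt (sqn {..<n} y)"
  define b where "b = sqrt (sqn {..<N} x)"
  have ab: "0 < a" "0 < b" using False by (simp_all add: a_def b_def order_le_neq_trans)
  have "bil n N A (\<lambda>i. inverse a * y i) (\<lambda>i. inverse b * x i) \<le> opn n N A"
    using ab by (intro bil_le_opn1) (simp_all only: sqn_cmult, simp_all add: a_def b_def power_inverse)
  then have "inverse a * (inverse b * bil n N A y x) \<le> opn n N A" by (simp only: bil_cmult)
  then show ?thesis using ab by (simp add: a_def[symmetric] b_def[symmetric] field_simps)
qed

lemma sqn_mact_le_opn: "sqrt (sqn {..<n} (mact {..<N} A x)) \<le> opn n N A * sqrt (sqn {..<N} x)"
proof (cases "sqn {..<n} (mact {..<N} A x) = 0")
  case False
  define a where "a = sqrt (sqn {..<n} (mact {..<N} A x))"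
  have a: "0 < a" using False by (simp add: a_def order_le_neq_trans)
  have "a * a = bil n N A (mact {..<N} A x) x"
    by (simp add: a_def bil_def sqn_def power2_eq_square sum_nonneg)
  also have "\<dots> \<le> opn n N A * a * sqrt (sqn {..<N} x)" unfolding a_def by (rule bil_le_opn)
  finally have "a * a \<le> a * (opn n N A * sqrt (sqn {..<N} x))" by (simp add: mult_ac)
  then show ?thesis using a by (simp add: a_def[symmetric])
qed (simp add: opn_nonneg)

text \<open>Passing to net points costs a quarter of the norm in each argument, so the norm is at
  most twice the maximum over the nets; the exponential of that maximum is one term of the
  sum.\<close>

lemma exp_opn_le_net_sum:
  assumes n: "0 < n" and N: "0 < N" and c: "0 \<le> c"
  shows "exp (c * opn n N A) \<le> (\<Sum>p\<in>l2_net n. \<Sum>q\<in>l2_net N. exp (2 * c * bil n N A p q))"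
proof -
  define W where "W = (\<lambda>(p, q). bil n N A p q) ` (l2_net n \<times> l2_net N)"
  have fW: "finite W" using l2_net_card(1) by (simp add: W_def)
  obtain p0 where p0: "p0 \<in> l2_net n" using l2_net[OF n, of "\<lambda>_. 0"] by (auto simp: sqn_def)
  obtain q0 where q0: "q0 \<in> l2_net N" using l2_net[OF N, of "\<lambda>_. 0"] by (auto simp: sqn_def)
  have W: "W \<noteq> {}" using p0 q0 by (auto simp: W_def)
  have "opn n N A \<le> Max W + opn n N A / 2"
    unfolding opn_def[of n N A]
  proof (rule cSup_least)
    show "{bil n N A y x | y x. sqn {..<n} y \<le> 1 \<and> sqn {..<N} x \<le> 1} \<noteq> {}"
      by (auto simp: sqn_def intro!: exI[of _ "\<lambda>_. 0"])
    fix v assume "v \<in> {bil n N A y x | y x. sqn {..<n} y \<le> 1 \<and> sqn {..<N} x \<le> 1}"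
    then obtain y x where v: "v = bil n N A y x" and y: "sqn {..<n} y \<le> 1" and x: "sqn {..<N} x \<le> 1"
      by blast
    obtain p where p: "p \<in> l2_net n" "sqn {..<n} (\<lambda>i. y i - p i) \<le> 1 / 16" using l2_net[OF n y] .
    obtain q where q: "q \<in> l2_net N" "sqn {..<N} (\<lambda>i. x i - q i) \<le> 1 / 16" using l2_net[OF N x] .
    have p1: "sqn {..<n} p \<le> 1" using p by (simp add: l2_net_def)
    have "bil n N A y x = bil n N A p q + bil n N A p (\<lambda>i. x i - q i) + bil n N A (\<lambda>i. y i - p i) x"
      by (simp add: bil_sum_sum sum.distrib[symmetric] algebra_simps)
    also have "bil n N A p q \<le> Max W" using p q fW by (intro Max_ge) (auto simp: W_def)
    also have "bil n N A p (\<lambda>i. x i - q i) \<le> opn n N A / 4"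
    proof -
      \<comment> \<open>The error has norm at most 1/4, so four times it lies in the unit
        ball.\<close>
      have "bil n N A p (\<lambda>i. 4 * (x i - q i)) \<le> opn n N A"
        by (rule bil_le_opn1[OF p1]) (simp only: sqn_cmult, use q(2) in simp)
      then have "4 * bil n N A p (\<lambda>i. x i - q i) \<le> opn n N A" by (simp only: bil_cmult)
      then show ?thesis by simp
    qed
    also have "bil n N A (\<lambda>i. y i - p i) x \<le> opn n N A / 4"
    proof -
      have "bil n N A (\<lambda>i. 4 * (y i - p i)) x \<le> opn n N A"
        by (rule bil_le_opn1[OF _ x]) (simp only: sqn_cmult, use p(2) in simp)
      then have "4 * bil n N A (\<lambda>i. y i - p i) x \<le> opn n N A" by (simp only: bil_cmult)
      then show ?thesis by simp
    qed
    finally show "v \<le> Max W + Sup {bil n N A y x | y x. sqn {..<n} y \<le> 1 \<and> sqn {..<N} x \<le> 1} / 2"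
      by (simp add: v opn_def)
  qed
  then have "opn n N A \<le> 2 * Max W" by linarith
  then have "exp (c * opn n N A) \<le> exp (2 * c * Max W)"
    using c mult_left_mono[of "opn n N A" "2 * Max W" c] by (simp add: mult_ac)
  also have "\<dots> \<le> (\<Sum>p\<in>l2_net n. \<Sum>q\<in>l2_net N. exp (2 * c * bil n N A p q))"
  proof -
    from Max_in[OF fW W] obtain pq where pq: "pq \<in> l2_net n \<times> l2_net N"
      and M: "Max W = bil n N A (fst pq) (snd pq)" by (auto simp: W_def)
    have "exp (2 * c * Max W) \<le> (\<Sum>pq\<in>l2_net n \<times> l2_net N. exp (2 * c * bil n N A (fst pq) (snd pq)))"
      unfolding M by (rule member_le_sum[OF pq]) (auto simp: l2_net_card)
    then show ?thesis by (simp add: sum.cartesian_product case_prod_beta)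
  qed
  finally show ?thesis .
qed

text \<open>The signs \<open>u\<close> are read row by row as in \<open>A1_law\<close>;
  \<open>s\<close> stands for the second Hadamard factor.\<close>

definition sign_matrix :: "nat \<Rightarrow> (nat \<Rightarrow> nat \<Rightarrow> real) \<Rightarrow> (nat \<Rightarrow> real) \<Rightarrow> nat \<Rightarrow> nat \<Rightarrow> real" where
  "sign_matrix N s u i j = u (i * N + j) * s i j"

lemma sum_div_mod:
  fixes g :: "nat \<Rightarrow> real"
  shows "(\<Sum>i<n. \<Sum>j<N. g (i * N + j)) = (\<Sum>m<n * N. g m)"
proof -
  have "(\<Sum>j<N. g (i * N + j)) = sum g {i * N..<i * N + N}" for i
    using sum.shift_bounds_nat_ivl[of g 0 "i * N" N]
    by (simp add: lessThan_atLeast0 add.commute)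
  then show ?thesis by (simp add: sum.nat_group)
qed

text \<open>For fixed test vectors the exponent is linear in the signs, with coefficients of square
  sum at most c^2.\<close>

lemma sign_avg_exp_bil:
  assumes s: "\<And>i j. i < n \<Longrightarrow> j < N \<Longrightarrow> \<bar>s i j\<bar> \<le> 1"
    and p: "sqn {..<n} p \<le> 1" and q: "sqn {..<N} q \<le> 1"
  shows "sign_avg (n * N) (\<lambda>u. exp (c * bil n N (sign_matrix N s u) p q)) \<le> exp (c\<^sup>2 / 2)"
proof -
  define w where "w = (\<lambda>m. c * (p (m div N) * q (m mod N) * s (m div N) (m mod N)))"
  have dm: "(i * N + j) div N = i" "(i * N + j) mod N = j" if "j < N" for i j using that by auto
  have "c * bil n N (sign_matrix N s u) p q = (\<Sum>m<n * N. w m * u m)" for u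
  proof -
    have "c * bil n N (sign_matrix N s u) p q = (\<Sum>i<n. \<Sum>j<N. w (i * N + j) * u (i * N + j))"
      unfolding bil_sum_sum sum_distrib_left
      by (intro sum.cong) (auto simp: w_def sign_matrix_def dm mult_ac)
    then show ?thesis by (simp add: sum_div_mod[of "\<lambda>m. w m * u m"])
  qed
  then have "sign_avg (n * N) (\<lambda>u. exp (c * bil n N (sign_matrix N s u) p q))
      \<le> exp ((\<Sum>m<n * N. (w m)\<^sup>2) / 2)" using sign_avg_exp_linear[of "n * N" w] by simp
  also have "(\<Sum>m<n * N. (w m)\<^sup>2) \<le> c\<^sup>2"
  proof -
    have "(\<Sum>m<n * N. (w m)\<^sup>2) = (\<Sum>i<n. \<Sum>j<N. (w (i * N + j))\<^sup>2)"
      by (simp add: sum_div_mod[of "\<lambda>m. (w m)\<^sup>2"])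
    also have "\<dots> \<le> (\<Sum>i<n. \<Sum>j<N. c\<^sup>2 * ((p i)\<^sup>2 * (q j)\<^sup>2))"
    proof (intro sum_mono)
      fix i j assume ij: "i \<in> {..<n}" "j \<in> {..<N}"
      then have "(s i j)\<^sup>2 \<le> 1" using s by (simp add: abs_square_le_1)
      then have "(p i * q j)\<^sup>2 * (s i j)\<^sup>2 \<le> (p i * q j)\<^sup>2" by (simp add: mult_left_le)
      then show "(w (i * N + j))\<^sup>2 \<le> c\<^sup>2 * ((p i)\<^sup>2 * (q j)\<^sup>2)"
        using ij by (auto simp: w_def dm power_mult_distrib mult.assoc intro!: mult_left_mono)
    qed
    also have "\<dots> = c\<^sup>2 * (sqn {..<n} p * sqn {..<N} q)"
      unfolding sqn_def by (subst sum_product) (simp add: sum_distrib_left)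
    also have "\<dots> \<le> c\<^sup>2 * 1" using p q by (intro mult_left_mono mult_le_one) auto
    finally show ?thesis by simp
  qed
  finally show ?thesis by simp
qed

lemma sign_avg_exp_opn:
  assumes s: "\<And>i j. i < n \<Longrightarrow> j < N \<Longrightarrow> \<bar>s i j\<bar> \<le> 1" and n: "0 < n" "n \<le> N"
  shows "sign_avg (n * N) (\<lambda>u. exp (sqrt (real N) * opn n N (sign_matrix N s u))) \<le> exp (38 * real N)"
proof -
  have N: "0 < N" using n by simp
  have "sign_avg (n * N) (\<lambda>u. exp (sqrt (real N) * opn n N (sign_matrix N s u)))
    \<le> sign_avg (n * N) (\<lambda>u. \<Sum>p\<in>l2_net n. \<Sum>q\<in>l2_net N.
        exp (2 * sqrt (real N) * bil n N (sign_matrix N s u) p q))"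
    by (intro sign_avg_mono exp_opn_le_net_sum n N) simp
  also have "\<dots> \<le> (\<Sum>p\<in>l2_net n. \<Sum>q\<in>l2_net N. exp (2 * real N))"
    unfolding sign_avg_sum
  proof (intro sum_mono)
    fix p q assume "p \<in> l2_net n" "q \<in> l2_net N"
    then show "sign_avg (n * N) (\<lambda>u. exp (2 * sqrt (real N) * bil n N (sign_matrix N s u) p q))
        \<le> exp (2 * real N)"
      using sign_avg_exp_bil[OF s, where c = "2 * sqrt (real N)" and p = p and q = q]
      by (simp add: l2_net_def power_mult_distrib)
  qed
  also have "\<dots> = real (card (l2_net n)) * (real (card (l2_net N)) * exp (2 * real N))" by simp
  also have "\<dots> \<le> exp (18 * real n) * (exp (18 * real N) * exp (2 * real N))"
    by (intro mult_mono l2_net_card) auto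
  \<comment> \<open>Two net cardinalities and c^2 / 2 with c = 2 sqrt N; as
    \<open>n \<le> N\<close>, they add up to at most 38 N.\<close>
  also have "\<dots> = exp (18 * real n + 18 * real N + 2 * real N)" by (simp only: exp_add mult.assoc)
  also have "\<dots> \<le> exp (38 * real N)" using n by simp
  finally show ?thesis .
qed

text \<open>Turns exponential moments into moments of order \<open>D\<close>: beyond
  \<open>a\<close>, raise x / a \<le> exp (x / a - 1) to the power \<open>D\<close> and use
  \<open>real D \<le> a * b\<close>.\<close>

lemma power_le_exp_tail:
  fixes x :: real
  assumes "0 \<le> x" "0 < a" "0 < b" "real D \<le> a * b"
  shows "x ^ D \<le> a ^ D * (1 + exp (b * x - a * b))"
proof (cases "x \<le> a")
  case True
  then have "x ^ D \<le> a ^ D * 1" using assms by (simp add: power_mono)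
  also have "\<dots> \<le> a ^ D * (1 + exp (b * x - a * b))" using assms by (intro mult_left_mono) auto
  finally show ?thesis .
next
  case False
  have "(x / a) ^ D \<le> exp (x / a - 1) ^ D"
    using assms exp_ge_add_one_self[of "x / a - 1"] by (intro power_mono) auto
  also have "\<dots> = exp (real D * (x / a - 1))" by (simp add: exp_of_nat_mult)
  also have "\<dots> \<le> exp ((a * b) * (x / a - 1))"
    using False assms by (auto intro!: mult_right_mono)
  also have "(a * b) * (x / a - 1) = b * x - a * b" using assms by (simp add: field_simps)
  finally have "(x / a) ^ D \<le> 1 + exp (b * x - a * b)" by simp
  then have "a ^ D * (x / a) ^ D \<le> a ^ D * (1 + exp (b * x - a * b))"
    using assms by (intro mult_left_mono) auto
  then show ?thesis using assms by (simp add: power_divide)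
qed

lemma sign_avg_opn_power:
  assumes s: "\<And>i j. i < n \<Longrightarrow> j < N \<Longrightarrow> \<bar>s i j\<bar> \<le> 1" and n: "0 < n" "n \<le> N"
    and D: "real D \<le> 38 * real N"
  shows "sign_avg (n * N) (\<lambda>u. opn n N (sign_matrix N s u) ^ D) \<le> 2 * (38 * sqrt (real N)) ^ D"
proof -
  have N: "0 < real N" using n by simp
  \<comment> \<open>Chosen so that the factor exp (- a sqrt N) cancels the exponential moment bound
    exp (38 N).\<close>
  define a where "a = 38 * sqrt (real N)"
  have ab: "a * sqrt (real N) = 38 * real N" and a0: "0 < a" using N by (simp_all add: a_def)
  have "sign_avg (n * N) (\<lambda>u. opn n N (sign_matrix N s u) ^ D)
      \<le> sign_avg (n * N) (\<lambda>u. a ^ D * (1 + exp (- (38 * real N)) *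
          exp (sqrt (real N) * opn n N (sign_matrix N s u))))"
  proof (rule sign_avg_mono)
    fix u
    have "opn n N (sign_matrix N s u) ^ D
        \<le> a ^ D * (1 + exp (sqrt (real N) * opn n N (sign_matrix N s u) - a * sqrt (real N)))"
      by (rule power_le_exp_tail) (use N D opn_nonneg ab a0 in auto)
    then show "opn n N (sign_matrix N s u) ^ D
        \<le> a ^ D * (1 + exp (- (38 * real N)) * exp (sqrt (real N) * opn n N (sign_matrix N s u)))"
      by (simp add: ab exp_add[symmetric])
  qed
  also have "\<dots> = a ^ D * (1 + exp (- (38 * real N)) *
      sign_avg (n * N) (\<lambda>u. exp (sqrt (real N) * opn n N (sign_matrix N s u))))"
    by (simp add: sign_avg_cmult sign_avg_add)
  also have "\<dots> \<le> a ^ D * (1 + exp (- (38 * real N)) * exp (38 * real N))"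
    using sign_avg_exp_opn[OF s n] by (intro mult_left_mono add_mono) (auto simp: a_def)
  also have "\<dots> = 2 * a ^ D" by (simp add: exp_add[symmetric])
  finally show ?thesis by (simp add: a_def)
qed

section \<open>Transfer of the norm bound to limited independence\<close>

definition gram :: "nat \<Rightarrow> (nat \<Rightarrow> nat \<Rightarrow> real) \<Rightarrow> nat \<Rightarrow> nat \<Rightarrow> real" where
  "gram n A = mmul {..<n} (\<lambda>j i. A i j) A"

text \<open>The squared Frobenius norm of the 2^r-th power of the Gram matrix: a polynomial in the
  entries that agrees with the power 4 * 2^r of the operator norm up to a factor
  \<open>N\<close>.\<close>

definition gram_power :: "nat \<Rightarrow> nat \<Rightarrow> nat \<Rightarrow> (nat \<Rightarrow> nat \<Rightarrow> real) \<Rightarrow> real" where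
  "gram_power n N r A = frob {..<N} {..<N} (msq {..<N} (gram n A) r)"

lemma gram_sym: "gram n A i j = gram n A j i"
  by (simp add: gram_def mmul_def mult.commute)

lemma gram_form:
  "(\<Sum>j<N. z j * mact {..<N} (gram n A) x j) = (\<Sum>i<n. mact {..<N} A z i * mact {..<N} A x i)"
proof -
  have "(\<Sum>i<n. mact {..<N} A z i * mact {..<N} A x i)
      = (\<Sum>i<n. mact {..<N} A x i * mact {..<N} A z i)" by (simp add: mult.commute)
  also have "\<dots> = (\<Sum>j<N. z j * mact {..<n} (\<lambda>j i. A i j) (mact {..<N} A x) j)"
    by (rule mact_mult_sum)
  finally show ?thesis by (simp add: gram_def mact_mmul)
qed

lemma sqn_mact_power_le_gram_power:
  assumes "sqn {..<N} x = 1"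
  shows "sqn {..<n} (mact {..<N} A x) ^ (2 * 2 ^ r) \<le> gram_power n N r A"
proof -
  have "sqn {..<n} (mact {..<N} A x) = (\<Sum>j<N. x j * mact {..<N} (gram n A) x j)"
    unfolding gram_form by (simp add: sqn_def power2_eq_square)
  then have "(sqn {..<n} (mact {..<N} A x))\<^sup>2 \<le> sqn {..<N} x * sqn {..<N} (mact {..<N} (gram n A) x)"
    using Cauchy_Schwarz_ineq_sum[of x "mact {..<N} (gram n A) x" "{..<N}"] by (simp add: sqn_def)
  then have "((sqn {..<n} (mact {..<N} A x))\<^sup>2) ^ 2 ^ r \<le> sqn {..<N} (mact {..<N} (gram n A) x) ^ 2 ^ r"
    using assms by (intro power_mono) auto
  also have "\<dots> \<le> sqn {..<N} (mact {..<N} (msq {..<N} (gram n A) r) x)"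
    by (rule sqn_mact_msq[OF gram_sym assms])
  also have "\<dots> \<le> gram_power n N r A"
    using sqn_mact_le_frob[of "{..<N}" "{..<N}" "msq {..<N} (gram n A) r" x] assms
    by (simp add: gram_power_def)
  finally show ?thesis by (simp add: power_mult)
qed

lemma sqn_mact_le_of_gram_power:
  assumes "gram_power n N r A \<le> B ^ (4 * 2 ^ r)" "0 \<le> B"
  shows "sqn {..<n} (mact {..<N} A x) \<le> B\<^sup>2 * sqn {..<N} x"
proof (cases "sqn {..<N} x = 0")
  case True
  then show ?thesis by (auto simp: sqn_def sum_nonneg_eq_0_iff mact_def)
next
  case False
  define a where "a = sqrt (sqn {..<N} x)"
  have a: "0 < a" "a\<^sup>2 = sqn {..<N} x" "0 < sqn {..<N} x"
    using False by (simp_all add: a_def order_le_neq_trans)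
  define z where "z = (\<lambda>i. inverse a * x i)"
  have z: "sqn {..<N} z = 1" using a by (simp add: z_def sqn_cmult power_inverse)
  have "mact {..<N} A z = (\<lambda>i. inverse a * mact {..<N} A x i)"
    by (auto simp: z_def mact_def sum_distrib_left mult_ac)
  then have Az: "sqn {..<n} (mact {..<N} A z) = inverse (a\<^sup>2) * sqn {..<n} (mact {..<N} A x)"
    by (simp add: sqn_cmult power_inverse)
  have "sqn {..<n} (mact {..<N} A z) ^ (2 * 2 ^ r) \<le> (B\<^sup>2) ^ (2 * 2 ^ r)"
    using sqn_mact_power_le_gram_power[OF z, of n A r] assms(1)
    by (simp add: power_mult[symmetric] mult.assoc[symmetric])
  then have "sqn {..<n} (mact {..<N} A z) \<le> B\<^sup>2"
    using power_mono_iff[of "sqn {..<n} (mact {..<N} A z)" "B\<^sup>2" "2 * 2 ^ r"] by simp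
  then show ?thesis using a by (simp add: Az field_simps)
qed

text \<open>By symmetry a row of the power is the image of a unit vector, so its norm is bounded by
  the operator norm; the \<open>N\<close> rows cost the factor \<open>N\<close>.\<close>

lemma gram_power_le_opn: "gram_power n N r A \<le> real N * opn n N A ^ (4 * 2 ^ r)"
proof -
  define S where "S = opn n N A"
  have base: "sqn {..<N} (mact {..<N} (gram n A) x) \<le> S ^ 4 * sqn {..<N} x" for x
  proof (cases "sqn {..<N} (mact {..<N} (gram n A) x) = 0")
    case False
    define y where "y = mact {..<N} (gram n A) x"
    define a where "a = sqrt (sqn {..<N} y)"
    define b where "b = sqrt (sqn {..<N} x)"
    have a: "0 < a" using False by (simp add: a_def y_def order_le_neq_trans)
    have S0: "0 \<le> S" by (simp add: S_def opn_nonneg)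
    \<comment> \<open>With y = Gx for the Gram matrix G, |y|^2 is the inner product of Ay and
      Ax.\<close>
    have "a * a = (\<Sum>i<n. mact {..<N} A y i * mact {..<N} A x i)"
      unfolding gram_form[symmetric] y_def[symmetric] by (simp add: a_def sqn_def power2_eq_square sum_nonneg)
    also have "\<dots> \<le> sqrt (sqn {..<n} (mact {..<N} A y)) * sqrt (sqn {..<n} (mact {..<N} A x))"
      unfolding real_sqrt_mult[symmetric] sqn_def by (intro real_le_rsqrt Cauchy_Schwarz_ineq_sum)
    also have "\<dots> \<le> (S * a) * (S * b)"
      unfolding S_def a_def b_def by (intro mult_mono sqn_mact_le_opn) (auto simp: opn_nonneg)
    finally have "a * a \<le> a * (S\<^sup>2 * b)" by (simp add: power2_eq_square mult_ac)
    then have "a \<le> S\<^sup>2 * b" using a by simp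
    then have "a\<^sup>2 \<le> (S\<^sup>2 * b)\<^sup>2" using a by (intro power_mono) auto
    then show ?thesis by (simp add: a_def b_def y_def power_mult_distrib)
  qed (simp add: S_def opn_nonneg)
  have iter: "sqn {..<N} (mact {..<N} (msq {..<N} (gram n A) r) x) \<le> S ^ (4 * 2 ^ r) * sqn {..<N} x" for x r
  proof (induction r arbitrary: x)
    case (Suc r)
    have "sqn {..<N} (mact {..<N} (msq {..<N} (gram n A) (Suc r)) x)
        \<le> S ^ (4 * 2 ^ r) * sqn {..<N} (mact {..<N} (msq {..<N} (gram n A) r) x)"
      by (simp add: mact_mmul Suc)
    also have "\<dots> \<le> S ^ (4 * 2 ^ r) * (S ^ (4 * 2 ^ r) * sqn {..<N} x)"
      using Suc by (intro mult_left_mono) (auto simp: S_def opn_nonneg)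
    also have "\<dots> = S ^ (4 * 2 ^ Suc r) * sqn {..<N} x"
      by (simp add: power_add[symmetric] mult.assoc[symmetric])
    finally show ?case .
  qed (use base in simp)
  have "sqn {..<N} (msq {..<N} (gram n A) r j) \<le> S ^ (4 * 2 ^ r)" if j: "j < N" for j
  proof -
    define e where "e = (\<lambda>i. if i = j then 1 else 0 :: real)"
    have e1: "sqn {..<N} e = 1" using j
      by (simp add: sqn_def e_def if_distrib[of "\<lambda>x. x\<^sup>2"] cong: if_cong)
    have "mact {..<N} (msq {..<N} (gram n A) r) e = msq {..<N} (gram n A) r j"
    proof
      fix i
      have "mact {..<N} (msq {..<N} (gram n A) r) e i = msq {..<N} (gram n A) r i j"
        using j by (simp add: mact_def e_def if_distrib[of "\<lambda>x. _ * x"] cong: if_cong)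
      then show "mact {..<N} (msq {..<N} (gram n A) r) e i = msq {..<N} (gram n A) r j i"
        using msq_sym[of "gram n A", OF gram_sym] by simp
    qed
    then show ?thesis using iter[of r e] e1 by simp
  qed
  then have "gram_power n N r A \<le> (\<Sum>j<N. S ^ (4 * 2 ^ r))"
    unfolding gram_power_def frob_def by (intro sum_mono) auto
  then show ?thesis by (simp add: S_def)
qed

text \<open>Gram entries are quadratic in the signs, each squaring doubles the degree, and the
  Frobenius norm doubles it once more.\<close>

lemma deg_le_gram_power:
  "deg_le (n * N) (4 * 2 ^ r) (\<lambda>u. gram_power n N r (sign_matrix N s u))"
proof -
  have var: "deg_le (n * N) 1 (\<lambda>u. sign_matrix N s u i j)" if "i < n" "j < N" for i j
  proof -
    have "i * N + j < Suc i * N" using that by simp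
    also have "\<dots> \<le> n * N" using that by (intro mult_le_mono1) simp
    finally have "i * N + j < n * N" .
    from deg_le_cmult[OF deg_le_var[OF this], of "s i j"] show ?thesis
      by (simp add: sign_matrix_def mult.commute)
  qed
  have g: "deg_le (n * N) 2 (\<lambda>u. gram n (sign_matrix N s u) i j)" if "i < N" "j < N" for i j
    unfolding gram_def mmul_def using deg_le_mult[OF var var] that
    by (intro deg_le_sum) (auto simp: numeral_2_eq_2)
  have m: "deg_le (n * N) (2 * 2 ^ r) (\<lambda>u. msq {..<N} (gram n (sign_matrix N s u)) r i j)"
    if "i < N" "j < N" for i j
    using that
  proof (induction r arbitrary: i j)
    case (Suc r)
    show ?case unfolding msq.simps mmul_def
    proof (intro deg_le_sum)
      fix k assume "k \<in> {..<N}"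
      then show "deg_le (n * N) (2 * 2 ^ Suc r) (\<lambda>u. msq {..<N} (gram n (sign_matrix N s u)) r i k *
          msq {..<N} (gram n (sign_matrix N s u)) r k j)"
        using deg_le_mult[OF Suc.IH[of i k] Suc.IH[of k j]] Suc.prems by (simp add: mult_2)
    qed
  qed (use g in simp)
  show ?thesis unfolding gram_power_def frob_def sqn_def
  proof (intro deg_le_sum)
    fix i j assume "i \<in> {..<N}" "j \<in> {..<N}"
    then show "deg_le (n * N) (4 * 2 ^ r) (\<lambda>u. (msq {..<N} (gram n (sign_matrix N s u)) r i j)\<^sup>2)"
      using deg_le_power[OF m, of i j 2] by simp
  qed
qed

lemma prob_le_expectation:
  assumes fin: "finite (set_pmf p)" and c: "0 < c"
    and nn: "\<And>\<omega>. \<omega> \<in> set_pmf p \<Longrightarrow> 0 \<le> F \<omega>"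
    and F: "\<And>\<omega>. \<omega> \<in> set_pmf p \<Longrightarrow> \<omega> \<in> S \<Longrightarrow> c \<le> F \<omega>"
  shows "measure_pmf.prob p S \<le> measure_pmf.expectation p F / c"
proof -
  have "c * measure_pmf.prob p S = measure_pmf.expectation p (\<lambda>\<omega>. c * indicat_real S \<omega>)"
    by simp
  also have "\<dots> \<le> measure_pmf.expectation p F"
    using nn F by (intro integral_mono_AE) (auto simp: AE_measure_pmf_iff indicator_def
        intro!: integrable_measure_pmf_finite fin)
  finally show ?thesis using c by (simp add: field_simps)
qed

text \<open>One polynomial controls all \<open>x\<close> at once. Its degree is at most
  \<open>k\<close>, so its mean is that for independent signs, and Markov's inequality
  applies.\<close>

lemma kwise_norm_bound:
  assumes fin: "finite (set_pmf p)" and k: "kwise_random_signs (measure_pmf p) k (n * N) X" and kM: "k \<le> n * N"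
    and sgn: "\<And>m \<omega>. m < n * N \<Longrightarrow> \<omega> \<in> set_pmf p \<Longrightarrow> X m \<omega> \<in> {- 1, 1}"
    and s: "\<And>i j. i < n \<Longrightarrow> j < N \<Longrightarrow> \<bar>s i j\<bar> \<le> 1" and n: "0 < n" "n \<le> N"
    and r: "4 * 2 ^ r \<le> k" "k \<le> 38 * N" and B: "0 < B"
  shows "measure_pmf.prob p {\<omega>. \<exists>x. B\<^sup>2 * sqn {..<N} x < sqn {..<n} (mact {..<N} (sign_matrix N s (\<lambda>m. X m \<omega>)) x)}
    \<le> 2 * real N * (38 * sqrt (real N) / B) ^ (4 * 2 ^ r)"
proof -
  let ?D = "4 * 2 ^ r :: nat"
  define F where "F = (\<lambda>u. gram_power n N r (sign_matrix N s u))"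
  have "measure_pmf.prob p {\<omega>. \<exists>x. B\<^sup>2 * sqn {..<N} x < sqn {..<n} (mact {..<N} (sign_matrix N s (\<lambda>m. X m \<omega>)) x)}
      \<le> measure_pmf.expectation p (\<lambda>\<omega>. F (\<lambda>m. X m \<omega>)) / B ^ ?D"
  proof (rule prob_le_expectation[OF fin])
    show "0 < B ^ ?D" using B by simp
    show "0 \<le> F (\<lambda>m. X m \<omega>)" for \<omega> by (auto simp: F_def gram_power_def frob_def intro!: sum_nonneg)
    fix \<omega> assume "\<omega> \<in> {\<omega>. \<exists>x. B\<^sup>2 * sqn {..<N} x < sqn {..<n} (mact {..<N} (sign_matrix N s (\<lambda>m. X m \<omega>)) x)}"
    then obtain x where "B\<^sup>2 * sqn {..<N} x < sqn {..<n} (mact {..<N} (sign_matrix N s (\<lambda>m. X m \<omega>)) x)" by blast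
    then show "B ^ ?D \<le> F (\<lambda>m. X m \<omega>)"
      using sqn_mact_le_of_gram_power[of n N r "sign_matrix N s (\<lambda>m. X m \<omega>)" B x] B
      unfolding F_def by linarith
  qed
  also have "measure_pmf.expectation p (\<lambda>\<omega>. F (\<lambda>m. X m \<omega>)) = sign_avg (n * N) F"
    by (rule kwise_expectation_deg_le[OF fin k kM sgn deg_le_gram_power[of n N r s, folded F_def] r(1)])
  also have "\<dots> \<le> sign_avg (n * N) (\<lambda>u. real N * opn n N (sign_matrix N s u) ^ ?D)"
    unfolding F_def by (intro sign_avg_mono gram_power_le_opn)
  also have "\<dots> \<le> real N * (2 * (38 * sqrt (real N)) ^ ?D)"
  proof -
    have "real ?D \<le> 38 * real N" using r of_nat_mono[of ?D "38 * N", where 'a = real] by linarith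
    then show ?thesis unfolding sign_avg_cmult by (intro mult_left_mono sign_avg_opn_power s n) auto
  qed
  finally show ?thesis using B by (simp add: power_divide divide_right_mono mult_ac)
qed

section \<open>Small ball estimate along the walk\<close>

text \<open>Invert exp x \<ge> 1 + x + x^2/2, noting that the product of 1 - x + x^2/2 and 1 + x +
  x^2/2 is 1 + x^4/4.\<close>

lemma exp_minus_le_quadratic:
  fixes x :: real
  assumes "0 \<le> x" shows "exp (- x) \<le> 1 - x + x\<^sup>2 / 2"
proof -
  have q: "0 < 1 + x + x\<^sup>2 / 2" using assms by (intro add_pos_nonneg) auto
  have "exp (- x) = inverse (exp x)" by (rule exp_minus)
  also have "\<dots> \<le> inverse (1 + x + x\<^sup>2 / 2)"
    using exp_lower_Taylor_quadratic[OF assms] q by (intro le_imp_inverse_le) auto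
  also have "\<dots> \<le> 1 - x + x\<^sup>2 / 2"
  proof -
    have "(1 - x + x\<^sup>2 / 2) * (1 + x + x\<^sup>2 / 2) = 1 + (x\<^sup>2)\<^sup>2 / 4"
      by (simp add: power2_eq_square field_simps)
    then have "1 \<le> (1 - x + x\<^sup>2 / 2) * (1 + x + x\<^sup>2 / 2)" by simp
    then show ?thesis using q by (simp add: inverse_eq_divide divide_le_eq)
  qed
  finally show ?thesis .
qed

text \<open>The squared weight is at most a quadratic polynomial in the square of the linear form,
  so only its second and fourth moments enter, and four-wise independence determines both.\<close>

lemma four_wise_gaussian_weight:
  assumes p: "finite (set_pmf p)" "kwise_random_signs (measure_pmf p) 4 N X" "4 \<le> N"
    and sgn: "\<And>m \<omega>. m < N \<Longrightarrow> \<omega> \<in> set_pmf p \<Longrightarrow> X m \<omega> \<in> {- 1, 1}"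
    and y: "sqn {..<N} y = 1"
  shows "measure_pmf.expectation p (\<lambda>\<omega>. (exp (- (\<Sum>j<N. y j * X j \<omega>)\<^sup>2 / 6))\<^sup>2) \<le> (94 / 100)\<^sup>2"
proof -
  define S where "S = (\<lambda>u :: nat \<Rightarrow> real. \<Sum>j<N. y j * u j)"
  have d: "deg_le N 1 S" unfolding S_def by (intro deg_le_sum deg_le_cmult deg_le_var) auto
  have E: "measure_pmf.expectation p (\<lambda>\<omega>. S (\<lambda>j. X j \<omega>) ^ e) = sign_avg N (\<lambda>u. S u ^ e)"
    if "e \<le> 4" for e
    using kwise_expectation_deg_le[OF p sgn deg_le_power[OF d, of e]] that by simp
  have E2: "measure_pmf.expectation p (\<lambda>\<omega>. (S (\<lambda>j. X j \<omega>))\<^sup>2) = 1"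
    using E[of 2] sign_avg_square_linear[where M = N and y = y] y by (simp add: S_def sqn_def)
  have E4: "measure_pmf.expectation p (\<lambda>\<omega>. S (\<lambda>j. X j \<omega>) ^ 4) \<le> 18 / 5"
    using E[of 4] sign_avg_fourth_linear[of y N] y by (simp add: S_def sqn_def)
  have "measure_pmf.expectation p (\<lambda>\<omega>. (exp (- (S (\<lambda>j. X j \<omega>))\<^sup>2 / 6))\<^sup>2)
      \<le> measure_pmf.expectation p (\<lambda>\<omega>. 1 - (1 / 3) * (S (\<lambda>j. X j \<omega>))\<^sup>2 + (1 / 18) * S (\<lambda>j. X j \<omega>) ^ 4)"
  proof (intro integral_mono integrable_measure_pmf_finite p)
    fix \<omega>
    define s where "s = S (\<lambda>j. X j \<omega>)"
    have "(exp (- s\<^sup>2 / 6))\<^sup>2 = exp (- (s\<^sup>2 / 3))"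
      by (simp add: power2_eq_square[of "exp _"] exp_add[symmetric])
    also have "\<dots> \<le> 1 - s\<^sup>2 / 3 + (s\<^sup>2 / 3)\<^sup>2 / 2" by (rule exp_minus_le_quadratic) simp
    also have "\<dots> = 1 - (1 / 3) * s\<^sup>2 + (1 / 18) * s ^ 4"
      by (simp add: power_divide power_mult[symmetric])
    finally show "(exp (- (S (\<lambda>j. X j \<omega>))\<^sup>2 / 6))\<^sup>2
        \<le> 1 - (1 / 3) * (S (\<lambda>j. X j \<omega>))\<^sup>2 + (1 / 18) * S (\<lambda>j. X j \<omega>) ^ 4"
      by (simp only: s_def)
  qed
  also have "\<dots> = 1 - (1 / 3) * measure_pmf.expectation p (\<lambda>\<omega>. (S (\<lambda>j. X j \<omega>))\<^sup>2)
      + (1 / 18) * measure_pmf.expectation p (\<lambda>\<omega>. S (\<lambda>j. X j \<omega>) ^ 4)"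
    by (simp add: integrable_measure_pmf_finite p)
  \<comment> \<open>The bound is 1 - 1/3 + 1/5 = 13/15, which is less than the square of
    0.94.\<close>
  also have "\<dots> \<le> (94 / 100)\<^sup>2" using E2 E4 by (simp add: power2_eq_square)
  finally show ?thesis by (simp add: S_def)
qed

text \<open>For fixed \<open>u\<close> and \<open>x\<close>, coordinate \<open>i\<close> of Ax
  depends only on the \<open>i\<close>-th vertex. So exp (- |Ax|^2 / (6 |x|^2)) is a product along
  the walk with geometrically small mean, and Markov's inequality applies.\<close>

lemma walk_small_ball:
  fixes G :: "real vec pair_pre_digraph"
  assumes G: "expander_graph G d (95 / 100)" and d: "0 < d" and N: "4 \<le> N"
    and V: "pverts G \<noteq> {}" "pverts G \<subseteq> sign_vecs N"
    and k: "kwise_random_signs (measure_pmf (pmf_of_set (pverts G))) 4 N (\<lambda>m u. u $ m)"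
    and u: "\<And>m. m < n * N \<Longrightarrow> u m \<in> {- 1, 1}"
    and x: "0 < sqn {..<N} x"
  shows "measure_pmf.prob (random_walk G n)
      {vs. sqn {..<n} (mact {..<N} (sign_matrix N (\<lambda>i j. vs ! i $ j) u) x) \<le> 6 / 1000 * real n * sqn {..<N} x}
    \<le> exp (- (2 / 1000) * real n)"
proof -
  from G have reg: "regular_graph G d" by (simp add: expander_graph_def)
  have fin: "finite (pverts G)" using regular_graphD(1)[OF reg] .
  have c0: "0 < real (card (pverts G))" using fin V by (simp add: card_gt_0_iff)
  define c where "c = sqn {..<N} x"
  define f where "f = (\<lambda>i v. exp (- (\<Sum>j<N. u (i * N + j) * x j / sqrt c * v $ j)\<^sup>2 / 6))"
  have f2: "sqn (pverts G) (f i) \<le> (94 / 100)\<^sup>2 * real (card (pverts G))" if i: "i < n" for i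
  proof -
    \<comment> \<open>The signs of \<open>u\<close> do not change the norm of \<open>x\<close>, so
      the vector tested against each vertex is a unit vector.\<close>
    have one: "(u (i * N + j))\<^sup>2 = 1" if "j < N" for j
    proof -
      have "i * N + j < Suc i * N" using that by simp
      also have "\<dots> \<le> n * N" using i by (intro mult_le_mono1) simp
      finally show ?thesis using u[of "i * N + j"] by auto
    qed
    have "sqn {..<N} (\<lambda>j. u (i * N + j) * x j / sqrt c) = (\<Sum>j<N. (x j)\<^sup>2 / c)"
      unfolding sqn_def using x one
      by (intro sum.cong) (auto simp: power_divide power_mult_distrib c_def)
    also have "\<dots> = 1" using x by (simp add: sum_divide_distrib[symmetric] c_def sqn_def)
    finally have y: "sqn {..<N} (\<lambda>j. u (i * N + j) * x j / sqrt c) = 1" .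
    have "measure_pmf.expectation (pmf_of_set (pverts G)) (\<lambda>v. (f i v)\<^sup>2) \<le> (94 / 100)\<^sup>2"
      unfolding f_def
      by (rule four_wise_gaussian_weight[OF _ k N _ y])
        (use fin V in \<open>auto simp: sign_vecs_def set_pmf_of_set\<close>)
    then have "(\<Sum>v\<in>pverts G. (f i v)\<^sup>2) / card (pverts G) \<le> (94 / 100)\<^sup>2"
      by (simp add: integral_pmf_of_set fin V)
    then show ?thesis using c0 by (simp add: sqn_def divide_le_eq)
  qed
  have E: "measure_pmf.expectation (random_walk G n) (\<lambda>vs. \<Prod>i<n. f i (vs ! i))
      \<le> ((1 - 95 / 100) * (94 / 100) + 95 / 100) ^ n"
    by (rule expander_walk_product[OF G d _ _ V(1)]) (use f2 in \<open>auto simp: f_def\<close>)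
  define S where "S = {vs. sqn {..<n} (mact {..<N} (sign_matrix N (\<lambda>i j. vs ! i $ j) u) x) \<le> 6 / 1000 * real n * c}"
  \<comment> \<open>On \<open>S\<close> the exponent is at least - (6/1000) n / 6 = - n /
    1000.\<close>
  have "measure_pmf.prob (random_walk G n) S
      \<le> measure_pmf.expectation (random_walk G n) (\<lambda>vs. \<Prod>i<n. f i (vs ! i)) / exp (- (1 / 1000) * real n)"
  proof (rule prob_le_expectation)
    show "finite (set_pmf (random_walk G n))" using random_walk_support(1)[OF reg d V(1)] .
    fix vs assume "vs \<in> S"
    then have S: "sqn {..<n} (mact {..<N} (sign_matrix N (\<lambda>i j. vs ! i $ j) u) x) \<le> 6 / 1000 * real n * c"
      by (simp add: S_def)
    have "(\<Sum>j<N. u (i * N + j) * x j / sqrt c * (vs ! i) $ j)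
        = mact {..<N} (sign_matrix N (\<lambda>i j. vs ! i $ j) u) x i / sqrt c" for i
      by (simp add: mact_def sign_matrix_def sum_divide_distrib mult_ac)
    then have "(\<Prod>i<n. f i (vs ! i))
        = exp (\<Sum>i<n. - (mact {..<N} (sign_matrix N (\<lambda>i j. vs ! i $ j) u) x i)\<^sup>2 / (6 * c))"
      using x by (simp add: f_def exp_sum power_divide c_def) (simp add: mult.commute)
    also have "(\<Sum>i<n. - (mact {..<N} (sign_matrix N (\<lambda>i j. vs ! i $ j) u) x i)\<^sup>2 / (6 * c))
        = - (sqn {..<n} (mact {..<N} (sign_matrix N (\<lambda>i j. vs ! i $ j) u) x) / (6 * c))"
      by (simp add: sqn_def sum_negf sum_divide_distrib)
    finally have P: "(\<Prod>i<n. f i (vs ! i))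
        = exp (- (sqn {..<n} (mact {..<N} (sign_matrix N (\<lambda>i j. vs ! i $ j) u) x) / (6 * c)))" .
    have "sqn {..<n} (mact {..<N} (sign_matrix N (\<lambda>i j. vs ! i $ j) u) x) / (6 * c) \<le> 1 / 1000 * real n"
      using S x by (simp add: divide_le_eq c_def)
    then show "exp (- (1 / 1000) * real n) \<le> (\<Prod>i<n. f i (vs ! i))" by (simp add: P)
  qed (auto simp: f_def intro!: prod_nonneg)
  also have "\<dots> \<le> exp (- (3 / 1000) * real n) / exp (- (1 / 1000) * real n)"
  proof (rule divide_right_mono)
    \<comment> \<open>The left side equals 1 - 3/1000.\<close>
    have "(1 - 95 / 100) * (94 / 100) + 95 / 100 \<le> exp (- (3 / 1000) :: real)"
      using exp_ge_add_one_self[of "- (3 / 1000) :: real"] by simp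
    then have "((1 - 95 / 100) * (94 / 100) + 95 / 100 :: real) ^ n \<le> exp (- (3 / 1000)) ^ n"
      by (intro power_mono) auto
    also have "\<dots> = exp (- (3 / 1000) * real n)" by (simp add: exp_of_nat_mult[symmetric] mult.commute)
    finally show "measure_pmf.expectation (random_walk G n) (\<lambda>vs. \<Prod>i<n. f i (vs ! i))
        \<le> exp (- (3 / 1000) * real n)" using E by simp
  qed simp
  also have "\<dots> = exp (- (2 / 1000) * real n)" by (simp add: exp_diff[symmetric])
  finally show ?thesis by (simp add: S_def c_def)
qed

section \<open>From a net to the kernel\<close>

text \<open>A unit kernel vector \<open>y\<close> of small l1 norm lies within squared distance
  \<open>e\<close> of a net point \<open>z\<close>. As Az = - A(y - z), |Az|^2 is at most b e \<le>
  h/4, against the lower bound assumed on the net.\<close>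

lemma kernel_l1_lower_bound:
  fixes A :: "nat \<Rightarrow> nat \<Rightarrow> real"
  assumes N: "0 < N" and D: "0 < D" and e: "0 < e" "e \<le> 1 / 4"
    and norm: "\<And>x. sqn {..<n} (mact {..<N} A x) \<le> b * sqn {..<N} x"
    and net: "\<And>m. m \<in> lattice_ball N (D\<^sup>2 * real N / e) \<Longrightarrow>
      0 < sqn {..<N} (\<lambda>i. e / (D * sqrt (real N)) * real_of_int (m i)) \<Longrightarrow>
      h * sqn {..<N} (\<lambda>i. e / (D * sqrt (real N)) * real_of_int (m i))
        < sqn {..<n} (mact {..<N} A (\<lambda>i. e / (D * sqrt (real N)) * real_of_int (m i)))"
    and b: "0 \<le> b" "b * e \<le> h / 4" and h: "0 \<le> h"
    and ker: "\<And>i. i < n \<Longrightarrow> mact {..<N} A x i = 0"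
  shows "D * sqrt (real N) * sqrt (sqn {..<N} x) \<le> (\<Sum>i<N. \<bar>x i\<bar>)"
proof (rule ccontr)
  define c where "c = sqrt (sqn {..<N} x)"
  define a where "a = D * sqrt (real N)"
  define t where "t = e / a"
  have a: "0 < a" using D N by (simp add: a_def)
  assume "\<not> D * sqrt (real N) * sqrt (sqn {..<N} x) \<le> (\<Sum>i<N. \<bar>x i\<bar>)"
  then have lt: "(\<Sum>i<N. \<bar>x i\<bar>) < a * c" by (simp add: a_def c_def)
  \<comment> \<open>The strict inequality also rules out x = 0, which permits normalising.\<close>
  then have "0 < a * c" by (intro order.strict_trans1[OF _ lt]) (simp add: sum_nonneg)
  then have c: "0 < c" using a by (simp add: zero_less_mult_iff)
  define y where "y = (\<lambda>i. inverse c * x i)"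
  have c2: "c\<^sup>2 = sqn {..<N} x" by (simp add: c_def)
  have y1: "sqn {..<N} y = 1" 
    unfolding y_def sqn_cmult c2[symmetric] using c by (simp add: power_inverse)
  have Ay: "mact {..<N} A y i = 0" if "i < n" for i
  proof -
    have "mact {..<N} A y i = inverse c * mact {..<N} A x i"
      by (simp add: mact_def y_def sum_distrib_left mult_ac)
    then show ?thesis using ker[OF that] by simp
  qed
  have "(\<Sum>i<N. \<bar>y i\<bar>) = (\<Sum>i<N. \<bar>x i\<bar>) / c"
    using c by (simp add: y_def abs_mult sum_distrib_left[symmetric] divide_inverse mult.commute)
  also have "\<dots> \<le> a" using lt c by (simp add: divide_le_eq)
  finally have ya: "(\<Sum>i<N. \<bar>y i\<bar>) \<le> a" .
  have t: "0 < t" using e a by (simp add: t_def)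
  obtain m where m: "m \<in> lattice_ball N (a / t)"
    and ym: "sqn {..<N} (\<lambda>i. y i - t * real_of_int (m i)) \<le> t * a" using l1_net[OF t ya] .
  define z where "z = (\<lambda>i. t * real_of_int (m i))"
  have ta: "t * a = e" using a by (simp add: t_def)
  have "a / t = a\<^sup>2 / e" using a e by (simp add: t_def power2_eq_square)
  also have "a\<^sup>2 = D\<^sup>2 * real N" by (simp add: a_def power_mult_distrib)
  finally have at: "a / t = D\<^sup>2 * real N / e" .
  have yz: "sqn {..<N} (\<lambda>i. y i - z i) \<le> e" using ym ta by (simp add: z_def)
  have "sqn {..<N} y \<le> (\<Sum>i<N. 2 * (y i - z i)\<^sup>2 + 2 * (z i)\<^sup>2)"
    unfolding sqn_def
  proof (rule sum_mono)
    fix i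
    have "0 \<le> (y i - 2 * z i)\<^sup>2" by simp
    then show "(y i)\<^sup>2 \<le> 2 * (y i - z i)\<^sup>2 + 2 * (z i)\<^sup>2"
      by (simp add: power2_eq_square algebra_simps)
  qed
  also have "\<dots> = 2 * sqn {..<N} (\<lambda>i. y i - z i) + 2 * sqn {..<N} z"
    by (simp add: sqn_def sum.distrib sum_distrib_left)
  \<comment> \<open>From 1 \<le> 2 e + 2 |z|^2 and e \<le> 1/4.\<close>
  finally have z4: "1 / 4 \<le> sqn {..<N} z" using y1 yz e by linarith
  have "h / 4 \<le> h * sqn {..<N} z" using mult_left_mono[OF z4 h] by simp
  also have "\<dots> < sqn {..<n} (mact {..<N} A z)"
    using net[of m] m z4 unfolding at by (simp add: z_def t_def a_def)
  also have "\<dots> = sqn {..<n} (mact {..<N} A (\<lambda>i. y i - z i))"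
    unfolding sqn_def
  proof (rule sum.cong)
    fix i assume "i \<in> {..<n}"
    then have "mact {..<N} A (\<lambda>i. y i - z i) i = - mact {..<N} A z i"
      using Ay[of i] by (simp add: mact_def right_diff_distrib sum_subtractf)
    then show "(mact {..<N} A z i)\<^sup>2 = (mact {..<N} A (\<lambda>i. y i - z i) i)\<^sup>2" by simp
  qed simp
  also have "\<dots> \<le> b * e" using norm[of "\<lambda>i. y i - z i"] mult_left_mono[OF yz b(1)] by linarith
  also have "\<dots> \<le> h / 4" by (rule b(2))
  finally show False by simp
qed

lemma l1_le_sqrt_l2: "(\<Sum>i<N. \<bar>x i\<bar>) \<le> sqrt (real N) * sqrt (sqn {..<N} x)"
  using L2_set_mult_ineq[of "\<lambda>_. 1" x "{..<N}"] by (simp add: L2_set_def sqn_def)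

text \<open>The choice of \<open>c'\<close>: with density \<open>z = 10\<^sup>-\<^sup>8 \<xi> / L\<close> of the \<open>\<ell>\<^sub>1\<close>-lattice ball, its
  entropy per coordinate stays below the exponent of the small ball estimate.\<close>

lemma net_entropy:
  fixes \<xi> :: real
  assumes "0 < \<xi>" "\<xi> < 1"
  defines "z \<equiv> 1 / 10 ^ 8 * \<xi> / max 1 (ln (1 / \<xi>))"
  shows "real (card (lattice_ball N (z * real N))) \<le> exp (5 / 10000 * \<xi> * real N)"
proof -
  define L where "L = max 1 (ln (1 / \<xi>))"
  have L: "1 \<le> L" "ln (1 / \<xi>) \<le> L" by (auto simp: L_def)
  have z: "0 < z" "z = 1 / 10 ^ 8 * \<xi> / L" using assms L by (auto simp: z_def L_def)
  \<comment> \<open>This rate makes \<open>exp c - 1\<close> equal to \<open>1 / z\<close>, so the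
    cardinality bound becomes exp (z (c + 2) N).\<close>
  define c where "c = ln (1 + 1 / z)"
  have c: "0 < c"
    unfolding c_def by (rule ln_gt_zero) (use z(1) in simp)
  have ec: "exp c - 1 = 1 / z" using z(1) by (simp add: c_def add_pos_pos)
  \<comment> \<open>K^2 exceeds 10^8 + 1, which absorbs the summand 1 next to \<open>1 / z\<close>;
    and ln K \<le> K - 1 = 10^4.\<close>
  define K :: real where "K = 10001"
  have K: "0 < K" by (simp add: K_def)
  have "1 + 1 / z \<le> K\<^sup>2 * (L / \<xi>)"
  proof -
    have "1 \<le> L / \<xi>" using L assms by (simp add: le_divide_eq)
    moreover have "1 / z = 10 ^ 8 * (L / \<xi>)" using z assms L by (simp add: field_simps)
    ultimately show ?thesis by (simp add: K_def)
  qed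
  then have "c \<le> ln (K\<^sup>2 * (L / \<xi>))" unfolding c_def using z assms by (intro ln_mono) (auto intro!: add_pos_pos)
  also have "\<dots> = 2 * ln K + ln L + ln (1 / \<xi>)"
    using L assms(1) K by (simp add: ln_mult ln_div ln_realpow)
  also have "\<dots> \<le> 2 * 10000 + L + L" using L ln_le_minus_one[of L] ln_le_minus_one[of K] by (simp add: K_def)
  also have "\<dots> \<le> 20002 * L" using L by simp
  finally have cL: "c \<le> 20002 * L" .
  have "real (card (lattice_ball N (z * real N))) \<le> exp (c * (z * real N) + 2 * real N / (exp c - 1))"
    by (rule lattice_ball_card(2)[OF c])
  also have "c * (z * real N) + 2 * real N / (exp c - 1) = z * (c + 2) * real N"
    by (simp add: ec algebra_simps)
  also have "exp (z * (c + 2) * real N) \<le> exp (5 / 10000 * \<xi> * real N)"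
  proof -
    have "z * (c + 2) \<le> z * (20004 * L)" using z cL L by (intro mult_left_mono) auto
    also have "\<dots> = 20004 / 10 ^ 8 * \<xi>" using z L by simp
    also have "\<dots> \<le> 5 / 10000 * \<xi>" using assms by (intro mult_right_mono) auto
    finally show ?thesis unfolding exp_le_cancel_iff by (rule mult_right_mono) simp
  qed
  finally show ?thesis .
qed

section \<open>Probability of the exceptional events\<close>

text \<open>Independence in the form of Fubini's theorem: one matrix is held fixed and the bound is
  uniform in it.\<close>

lemma prob_pair_le1:
  assumes "\<And>a. a \<in> set_pmf p \<Longrightarrow> measure_pmf.prob q {b. R a b} \<le> c" "0 \<le> c"
  shows "measure_pmf.prob (pair_pmf p q) {(a, b). R a b} \<le> c"
proof -
  have "emeasure (pair_pmf p q) {(a, b). R a b} = (\<integral>\<^sup>+x. indicator {(a, b). R a b} x \<partial>pair_pmf p q)"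
    by simp
  also have "\<dots> = (\<integral>\<^sup>+a. \<integral>\<^sup>+b. indicator {(a, b). R a b} (a, b) \<partial>q \<partial>p)"
    by (rule nn_integral_pair_pmf')
  also have "\<dots> = (\<integral>\<^sup>+a. emeasure q {b. R a b} \<partial>p)"
  proof (rule nn_integral_cong)
    fix a
    have "(\<integral>\<^sup>+b. indicator {(a, b). R a b} (a, b) \<partial>q) = (\<integral>\<^sup>+b. indicator {b. R a b} b \<partial>q)"
      by (rule nn_integral_cong) (auto simp: indicator_def)
    then show "(\<integral>\<^sup>+b. indicator {(a, b). R a b} (a, b) \<partial>q) = emeasure q {b. R a b}" by simp
  qed
  also have "\<dots> \<le> (\<integral>\<^sup>+a. ennreal c \<partial>p)"
    using assms by (intro nn_integral_mono_AE)
      (auto simp: AE_measure_pmf_iff measure_pmf.emeasure_eq_measure ennreal_leI)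
  also have "\<dots> = ennreal c" by (simp add: measure_pmf.emeasure_space_1[simplified])
  finally show ?thesis using assms(2) by (simp add: measure_pmf.emeasure_eq_measure)
qed

lemma prob_pair_le2:
  assumes "\<And>b. b \<in> set_pmf q \<Longrightarrow> measure_pmf.prob p {a. R a b} \<le> c" "0 \<le> c"
  shows "measure_pmf.prob (pair_pmf p q) {(a, b). R a b} \<le> c"
proof -
  have "measure_pmf.prob (pair_pmf p q) {(a, b). R a b}
      = measure_pmf.prob (pair_pmf q p) ((\<lambda>(x, y). (y, x)) -` {(a, b). R a b})"
    by (subst pair_commute_pmf) simp
  also have "(\<lambda>(x, y). (y, x)) -` {(a, b). R a b} = {(b, a). R a b}" by auto
  also have "measure_pmf.prob (pair_pmf q p) \<dots> \<le> c" by (rule prob_pair_le1[OF assms])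
  finally show ?thesis .
qed

section \<open>Kernels of random matrices\<close>

lemma sign_vecs_nth: "v \<in> sign_vecs M \<Longrightarrow> m < M \<Longrightarrow> v $ m \<in> {- 1, 1}"
  by (auto simp: sign_vecs_def)

lemma lp_norm_1: "lp_norm 1 x = (\<Sum>i<dim_vec x. \<bar>x $ i\<bar>)"
  by (simp add: lp_norm_def sum_nonneg)

lemma lp_norm_2: "lp_norm 2 x = sqrt (sqn {..<dim_vec x} (\<lambda>i. x $ i))"
proof -
  have "(\<Sum>i<dim_vec x. \<bar>x $ i\<bar> powr 2) = sqn {..<dim_vec x} (\<lambda>i. x $ i)"
    unfolding sqn_def by (rule sum.cong) (auto simp: powr_numeral)
  then show ?thesis by (simp add: lp_norm_def powr_half_sqrt)
qed

lemma hadamard_kernel: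
  assumes x: "x \<in> mat_kernel (mat n N (\<lambda>(i, j). u $ (i * N + j)) \<bullet>\<^sub>H mat_of_rows N vs)"
    and vs: "length vs = n"
  shows "dim_vec x = N"
    "i < n \<Longrightarrow> mact {..<N} (sign_matrix N (\<lambda>i j. vs ! i $ j) (\<lambda>m. u $ m)) (\<lambda>j. x $ j) i = 0"
proof -
  let ?A = "mat n N (\<lambda>(i, j). u $ (i * N + j)) \<bullet>\<^sub>H mat_of_rows N vs"
  have x: "x \<in> carrier_vec N" and Ax: "?A *\<^sub>v x = 0\<^sub>v n"
    using x by (auto simp: mat_kernel_def hadamard_prod_def)
  show d: "dim_vec x = N" using x by simp
  assume i: "i < n"
  have "mact {..<N} (sign_matrix N (\<lambda>i j. vs ! i $ j) (\<lambda>m. u $ m)) (\<lambda>j. x $ j) i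
      = (\<Sum>j = 0..<N. ?A $$ (i, j) * x $ j)"
    using i vs by (auto simp: mact_def sign_matrix_def hadamard_prod_def mat_of_rows_def
        lessThan_atLeast0 intro!: sum.cong)
  also have "\<dots> = (?A *\<^sub>v x) $ i"
    using i d by (auto simp: scalar_prod_def hadamard_prod_def intro!: sum.cong)
  finally show "mact {..<N} (sign_matrix N (\<lambda>i j. vs ! i $ j) (\<lambda>m. u $ m)) (\<lambda>j. x $ j) i = 0"
    using i Ax by simp
qed

text \<open>Two bad events are excluded: a norm above C sqrt N, unlikely in the first factor for
  each fixed second one, and a small image of a net point, unlikely in the second for each fixed
  first.\<close>

lemma kernel_norms_prob:
  fixes \<xi> C c' :: real and U :: "real vec set" and G :: "real vec pair_pre_digraph"
  assumes \<xi>: "0 < \<xi>" "\<xi> < 1" and n: "0 < n" "n \<le> N" "\<xi> * real N / 2 \<le> real n" and N: "4 \<le> N"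
    and C: "1 \<le> C" and c': "0 < c'" "c'\<^sup>2 = 6 / (8 * 1000 * 10 ^ 8 * C\<^sup>2)"
    and G: "expander_graph G d (95 / 100)" and d: "0 < d"
    and V: "pverts G \<noteq> {}" "pverts G \<subseteq> sign_vecs N"
    and k4: "kwise_random_signs (measure_pmf (pmf_of_set (pverts G))) 4 N (\<lambda>m u. u $ m)"
    and U: "finite U" "U \<noteq> {}" "U \<subseteq> sign_vecs (n * N)"
    and k: "kwise_random_signs (measure_pmf (pmf_of_set U)) k (n * N) (\<lambda>m u. u $ m)"
    and kn: "k \<le> n * N" "k \<le> 38 * N" and r: "4 * 2 ^ r \<le> k"
  shows "1 - (2 * real N * (38 / C) ^ (4 * 2 ^ r) + exp (- (5 / 10000) * \<xi> * real N))
    \<le> measure_pmf.prob (pair_pmf (A1_law U n N) (A2_law G n N))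
         {(A1, A2). \<forall>x \<in> mat_kernel (A1 \<bullet>\<^sub>H A2).
            c' * \<xi> / sqrt (max 1 (ln (1 / \<xi>))) * sqrt (real N) * lp_norm 2 x \<le> lp_norm 1 x \<and>
            lp_norm 1 x \<le> sqrt (real N) * lp_norm 2 x}"
proof -
  define p where "p = pmf_of_set U"
  define q where "q = random_walk G n"
  define B where "B = (\<lambda>u vs. sign_matrix N (\<lambda>i j. vs ! i $ j) (\<lambda>m. u $ m :: real))"
  define L where "L = max 1 (ln (1 / \<xi>))"
  define D where "D = c' * \<xi> / sqrt L"
  \<comment> \<open>Then C^2 N e = (6/1000) \<xi> N / 8, at most a quarter of (6/1000) n since n
    \<ge> \<xi> N / 2.\<close>
  define e where "e = 6 / 1000 * \<xi> / (8 * C\<^sup>2)"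
  have L: "1 \<le> L" by (simp add: L_def)
  have D: "0 < D" using c' \<xi> L by (simp add: D_def)
  have C2: "1 \<le> C\<^sup>2" using C by (simp add: one_le_power)
  have e: "0 < e" using \<xi> C by (simp add: e_def)
  have e4: "e \<le> 1 / 4"
  proof -
    have "6 / 1000 * \<xi> / (8 * C\<^sup>2) \<le> 6 / 1000 * \<xi> / 8"
      using \<xi> C2 by (intro divide_left_mono) auto
    then show ?thesis using \<xi> by (simp add: e_def)
  qed
  \<comment> \<open>The prescribed square of \<open>c'\<close> is what makes the lattice radius the
    one in \<open>net_entropy\<close>.\<close>
  have s: "D\<^sup>2 * real N / e = (1 / 10 ^ 8 * \<xi> / L) * real N"
    using \<xi> C L by (simp add: D_def e_def power_divide power_mult_distrib c'(2) power2_eq_square[of \<xi>])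
  define z where "z = (\<lambda>(m :: nat \<Rightarrow> int) i. e / (D * sqrt (real N)) * real_of_int (m i))"
  define bad1 where "bad1 = (\<lambda>u vs. \<exists>x. (C * sqrt (real N))\<^sup>2 * sqn {..<N} x < sqn {..<n} (mact {..<N} (B u vs) x))"
  define M where "M = {m \<in> lattice_ball N (D\<^sup>2 * real N / e). 0 < sqn {..<N} (z m)}"
  define bad2 where "bad2 = (\<lambda>u vs. \<exists>m\<in>M. sqn {..<n} (mact {..<N} (B u vs) (z m)) \<le> 6 / 1000 * real n * sqn {..<N} (z m))"
  define good where "good = (\<lambda>(u, vs). \<forall>x \<in> mat_kernel (mat n N (\<lambda>(i, j). u $ (i * N + j)) \<bullet>\<^sub>H mat_of_rows N vs).
      D * sqrt (real N) * lp_norm 2 x \<le> lp_norm 1 x \<and> lp_norm 1 x \<le> sqrt (real N) * lp_norm 2 x)"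
  from G have reg: "regular_graph G d" by (simp add: expander_graph_def)
  have set_p: "set_pmf p = U" using U by (simp add: p_def)
  have q: "length vs = n" "set vs \<subseteq> pverts G" if "vs \<in> set_pmf q" for vs
    using random_walk_support(2)[OF reg d V(1)] that by (auto simp: q_def)
  have fM: "finite M" unfolding M_def using lattice_ball_card(1)[of 1] by simp

  have us: "u $ m \<in> {- 1, 1}" if "u \<in> set_pmf p" "m < n * N" for u m
    using that U(3) sign_vecs_nth unfolding set_p by blast

  have P1: "measure_pmf.prob (pair_pmf p q) {(u, vs). bad1 u vs} \<le> 2 * real N * (38 / C) ^ (4 * 2 ^ r)"
  proof (rule prob_pair_le2)
    fix vs assume vs: "vs \<in> set_pmf q"
    have sb: "\<bar>vs ! i $ j\<bar> \<le> 1" if "i < n" "j < N" for i j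
    proof -
      have "vs ! i \<in> set vs" using q(1)[OF vs] that by simp
      then have "vs ! i \<in> sign_vecs N" using q(2)[OF vs] V(2) by blast
      from sign_vecs_nth[OF this that(2)] show ?thesis by auto
    qed
    have "measure_pmf.prob p {u. \<exists>x. (C * sqrt (real N))\<^sup>2 * sqn {..<N} x
        < sqn {..<n} (mact {..<N} (sign_matrix N (\<lambda>i j. vs ! i $ j) (\<lambda>m. u $ m)) x)}
      \<le> 2 * real N * (38 * sqrt (real N) / (C * sqrt (real N))) ^ (4 * 2 ^ r)"
      by (rule kwise_norm_bound[OF _ k[folded p_def] kn(1) _ _ n(1,2) r kn(2)])
        (use C N U(1) sb us set_p in auto)
    then show "measure_pmf.prob p {u. bad1 u vs} \<le> 2 * real N * (38 / C) ^ (4 * 2 ^ r)"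
      using N by (simp add: bad1_def B_def)
  qed (use C in simp)

  have P2: "measure_pmf.prob (pair_pmf p q) {(u, vs). bad2 u vs} \<le> exp (- (5 / 10000) * \<xi> * real N)"
  proof (rule prob_pair_le1)
    fix u assume u: "u \<in> set_pmf p"
    define E where "E = (\<lambda>m. {vs. sqn {..<n} (mact {..<N} (B u vs) (z m)) \<le> 6 / 1000 * real n * sqn {..<N} (z m)})"
    have "measure_pmf.prob q {vs. bad2 u vs} = measure_pmf.prob q (\<Union>m\<in>M. E m)"
      by (rule arg_cong[of _ _ "measure_pmf.prob q"]) (auto simp: bad2_def E_def)
    also have "\<dots> \<le> (\<Sum>m\<in>M. measure_pmf.prob q (E m))"
      by (rule measure_pmf.finite_measure_subadditive_finite[OF fM]) auto
    also have "\<dots> \<le> (\<Sum>m\<in>M. exp (- (2 / 1000) * real n))"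
    proof (rule sum_mono)
      fix m assume m: "m \<in> M"
      have "u $ l \<in> {- 1, 1}" if "l < n * N" for l using us[OF u that] .
      from walk_small_ball[OF G d N V k4 this, where x = "z m"] m
      show "measure_pmf.prob q (E m) \<le> exp (- (2 / 1000) * real n)"
        by (simp add: E_def B_def q_def M_def)
    qed
    also have "\<dots> = real (card M) * exp (- (2 / 1000) * real n)" by simp
    also have "\<dots> \<le> exp (5 / 10000 * \<xi> * real N) * exp (- (2 / 1000) * real n)"
    proof (rule mult_right_mono)
      have "card M \<le> card (lattice_ball N ((1 / 10 ^ 8 * \<xi> / L) * real N))"
        unfolding M_def s by (intro card_mono lattice_ball_card(1)[of 1]) auto
      then show "real (card M) \<le> exp (5 / 10000 * \<xi> * real N)"
        using net_entropy[OF \<xi>, of N] unfolding L_def by linarith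
    qed simp
    \<comment> \<open>Since n \<ge> \<xi> N / 2, the small ball exponent is at least twice the
      entropy exponent.\<close>
    also have "\<dots> \<le> exp (- (5 / 10000) * \<xi> * real N)"
      using n(3) by (simp add: exp_add[symmetric])
    finally show "measure_pmf.prob q {vs. bad2 u vs} \<le> exp (- (5 / 10000) * \<xi> * real N)" .
  qed simp

  have good: "good (u, vs)" if uv: "u \<in> set_pmf p" "vs \<in> set_pmf q" "\<not> bad1 u vs" "\<not> bad2 u vs" for u vs
    unfolding good_def prod.case
  proof (intro ballI conjI)
    fix x assume x: "x \<in> mat_kernel (mat n N (\<lambda>(i, j). u $ (i * N + j)) \<bullet>\<^sub>H mat_of_rows N vs)"
    note hk = hadamard_kernel[OF x q(1)[OF uv(2)]]
    have "D * sqrt (real N) * sqrt (sqn {..<N} (\<lambda>j. x $ j)) \<le> (\<Sum>i<N. \<bar>x $ i\<bar>)"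
    proof (rule kernel_l1_lower_bound[where A = "B u vs" and n = n and e = e
          and b = "(C * sqrt (real N))\<^sup>2" and h = "6 / 1000 * real n"])
      show "(C * sqrt (real N))\<^sup>2 * e \<le> 6 / 1000 * real n / 4"
        using n(3) C by (simp add: e_def power_mult_distrib)
    qed (use N D e e4 uv(3,4) hk(2) in \<open>auto simp: bad1_def bad2_def M_def z_def B_def not_less not_le\<close>)
    then show "D * sqrt (real N) * lp_norm 2 x \<le> lp_norm 1 x"
      by (simp add: lp_norm_1 lp_norm_2 hk(1))
    show "lp_norm 1 x \<le> sqrt (real N) * lp_norm 2 x"
      using l1_le_sqrt_l2[of "\<lambda>j. x $ j" N] by (simp add: lp_norm_1 lp_norm_2 hk(1))
  qed

  have "pair_pmf (A1_law U n N) (A2_law G n N)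
      = map_pmf (\<lambda>(u, vs). (mat n N (\<lambda>(i, j). u $ (i * N + j)), mat_of_rows N vs)) (pair_pmf p q)"
    unfolding A1_law_def A2_law_def p_def q_def by (rule map_pair[symmetric])
  then have "measure_pmf.prob (pair_pmf (A1_law U n N) (A2_law G n N))
         {(A1, A2). \<forall>x \<in> mat_kernel (A1 \<bullet>\<^sub>H A2).
            c' * \<xi> / sqrt (max 1 (ln (1 / \<xi>))) * sqrt (real N) * lp_norm 2 x \<le> lp_norm 1 x \<and>
            lp_norm 1 x \<le> sqrt (real N) * lp_norm 2 x}
      = measure_pmf.prob (pair_pmf p q) {uv. good uv}" (is "?P = _")
    by (simp add: good_def D_def L_def vimage_def case_prod_beta)
  moreover have "1 = measure_pmf.prob (pair_pmf p q) ({uv. good uv} \<union> ({(u, vs). bad1 u vs} \<union> {(u, vs). bad2 u vs}))"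
    by (rule measure_pmf.prob_eq_1[THEN iffD2, symmetric]) (use good in \<open>auto simp: AE_measure_pmf_iff\<close>)
  moreover have "\<dots> \<le> measure_pmf.prob (pair_pmf p q) {uv. good uv} +
      (measure_pmf.prob (pair_pmf p q) {(u, vs). bad1 u vs} + measure_pmf.prob (pair_pmf p q) {(u, vs). bad2 u vs})"
    by (intro order_trans[OF measure_Un_le] add_left_mono measure_Un_le) auto
  ultimately show ?thesis using P1 P2 by linarith
qed

text \<open>With the largest admissible \<open>r\<close>, the degree D = 4 * 2^r exceeds k/2, so D
  is at least (C1/2) ln n. The ratio exp (- 4/C1) then yields n^(-2), which beats the factor
  \<open>N\<close>.\<close>

lemma norm_exponent:
  assumes C1: "0 < C1" and n: "0 < n" "\<xi> * real N / 2 \<le> real n" and \<xi>: "0 < \<xi>" and N: "0 < N"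
    and k: "C1 * ln (real n) \<le> real k" "4 \<le> k"
  obtains r where "4 * 2 ^ r \<le> k"
    "2 * real N * (38 / (38 * exp (4 / C1))) ^ (4 * 2 ^ r) \<le> 8 / (\<xi>\<^sup>2 * real N)"
proof -
  obtain r where r: "2 ^ r \<le> k div 4" "k div 4 < 2 ^ (r + 1)"
    using ex_power_ivl1[of 2 "k div 4"] div_le_mono[OF k(2), of 4] by auto
  define D where "D = (4 * 2 ^ r :: nat)"
  have D: "D \<le> k" using r by (simp add: D_def)
  have "k < 2 * D" using r by (simp add: D_def)
  then have "C1 * ln (real n) \<le> 2 * real D" using k(1) by linarith
  then have "4 / C1 * (C1 * ln (real n)) \<le> 4 / C1 * (2 * real D)" using C1 by (intro mult_left_mono) auto
  then have lnD: "2 * ln (real n) \<le> real D * (4 / C1)" using C1 by simp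
  have "(38 / (38 * exp (4 / C1))) ^ D = exp (- (real D * (4 / C1)))"
    unfolding exp_minus exp_of_nat_mult by (simp add: power_divide inverse_eq_divide)
  also have "\<dots> \<le> exp (- (2 * ln (real n)))" using lnD by simp
  also have "\<dots> = 1 / (real n)\<^sup>2"
    using n by (simp add: exp_minus exp_double exp_ln inverse_eq_divide power_one_over)
  also have "\<dots> \<le> 1 / (\<xi> * real N / 2)\<^sup>2"
    using n \<xi> N by (intro divide_left_mono power_mono) auto
  finally have "2 * real N * (38 / (38 * exp (4 / C1))) ^ D \<le> 2 * real N * (1 / (\<xi> * real N / 2)\<^sup>2)"
    by (intro mult_left_mono) auto
  also have "\<dots> = 8 / (\<xi>\<^sup>2 * real N)"
    using \<xi> N by (simp add: power2_eq_square field_simps)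
  finally show thesis using that D by (simp add: D_def)
qed

text \<open>The constant \<open>c'\<close> depends on \<open>C1\<close> alone. The maximum with 1
  matters for \<xi> near 1, where ln (1/\<xi>) tends to 0 and the lower bound would exceed the upper
  one.\<close>

theorem theorem6:
  fixes C1 :: real
  assumes "C1 > 0"
  shows "\<exists>c'>0. \<forall>(\<xi> :: real) (d :: nat) \<Upsilon> C \<phi> G (k :: nat \<Rightarrow> nat).
    0 < \<xi> \<and> \<xi> < 1 \<and> 3 \<le> d \<and>
    explicit_kwise_family \<Upsilon> C \<phi> \<and>
    explicit_expander_family \<Upsilon> C \<phi> d (95 / 100) G \<and>
    (\<lambda>n. real (k n)) \<in> \<Theta>(\<lambda>n. ln (real n)) \<and>
    (\<forall>\<^sub>F n in sequentially. C1 * ln (real n) \<le> real (k n))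
    \<longrightarrow>
    (\<lambda>N. let n = nat \<lfloor>\<xi> * real N\<rfloor> in
       measure_pmf.prob (pair_pmf (A1_law (\<Upsilon> (k n) (n * N)) n N) (A2_law (G N) n N))
         {(A1, A2). \<forall>x \<in> mat_kernel (A1 \<bullet>\<^sub>H A2).
            c' * \<xi> / sqrt (max 1 (ln (1 / \<xi>))) * sqrt (real N) * lp_norm 2 x \<le> lp_norm 1 x \<and>
            lp_norm 1 x \<le> sqrt (real N) * lp_norm 2 x})
      \<longlonglongrightarrow> 1"
proof -
  define C where "C = 38 * exp (4 / C1)"
  define c' where "c' = sqrt (6 / (8 * 1000 * 10 ^ 8 * C\<^sup>2))"
  have "1 \<le> exp (4 / C1)" using assms by simp
  then have C: "1 \<le> C" unfolding C_def by linarith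
  have c': "0 < c'" "c'\<^sup>2 = 6 / (8 * 1000 * 10 ^ 8 * C\<^sup>2)" using C by (simp_all add: c'_def)
  show ?thesis
  proof (intro exI[of _ c'] conjI c'(1) allI impI, elim conjE)
    fix \<xi> :: real and d :: nat and \<Upsilon> Cf \<phi> G and k :: "nat \<Rightarrow> nat"
    assume \<xi>: "0 < \<xi>" "\<xi> < 1" and d: "3 \<le> d"
      and fam: "explicit_kwise_family \<Upsilon> Cf \<phi>"
      and ex: "explicit_expander_family \<Upsilon> Cf \<phi> d (95 / 100) G"
      and kT: "(\<lambda>n. real (k n)) \<in> \<Theta>(\<lambda>n. ln (real n))"
      and kC: "\<forall>\<^sub>F n in sequentially. C1 * ln (real n) \<le> real (k n)"
    define \<nu> where "\<nu> = (\<lambda>N. nat \<lfloor>\<xi> * real N\<rfloor>)"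
    define P where "P = (\<lambda>N. measure_pmf.prob (pair_pmf (A1_law (\<Upsilon> (k (\<nu> N)) (\<nu> N * N)) (\<nu> N) N) (A2_law (G N) (\<nu> N) N))
         {(A1, A2). \<forall>x \<in> mat_kernel (A1 \<bullet>\<^sub>H A2).
            c' * \<xi> / sqrt (max 1 (ln (1 / \<xi>))) * sqrt (real N) * lp_norm 2 x \<le> lp_norm 1 x \<and>
            lp_norm 1 x \<le> sqrt (real N) * lp_norm 2 x})"
    have famD: "\<Upsilon> k M \<subseteq> sign_vecs M" "finite (\<Upsilon> k M)" "\<Upsilon> k M \<noteq> {}"
      "kwise_random_signs (measure_pmf (pmf_of_set (\<Upsilon> k M))) k M (\<lambda>m u. u $ m)"
      if "1 \<le> k" "k \<le> M" for k M
    proof -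
      have c: "card (\<Upsilon> k M) = 2 ^ Cf k M" and *: "\<Upsilon> k M \<subseteq> sign_vecs M"
        "kwise_random_signs (measure_pmf (pmf_of_set (\<Upsilon> k M))) k M (\<lambda>m u. u $ m)"
        using fam that unfolding explicit_kwise_family_def by blast+
      have "card (\<Upsilon> k M) > 0" using c by simp
      then show "finite (\<Upsilon> k M)" "\<Upsilon> k M \<noteq> {}" by (simp_all add: card_gt_0_iff)
      show "\<Upsilon> k M \<subseteq> sign_vecs M"
        "kwise_random_signs (measure_pmf (pmf_of_set (\<Upsilon> k M))) k M (\<lambda>m u. u $ m)" using * by blast+
    qed
    have exD: "\<forall>\<^sub>F N in sequentially. pverts (G N) = \<Upsilon> 4 N \<and> expander_graph (G N) d (95 / 100)"
      using ex unfolding explicit_expander_family_def by blast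
    have \<nu>_top: "filterlim \<nu> at_top sequentially" unfolding \<nu>_def using \<xi>(1) by real_asymp
    \<comment> \<open>The integer part loses at most 1, that is, at most half of \<xi> N.\<close>
    have \<nu>_lin: "\<xi> * real N / 2 \<le> real (\<nu> N)" if "2 \<le> \<xi> * real N" for N
      using that unfolding \<nu>_def by linarith
    have \<nu>_le: "\<nu> N \<le> N" for N
    proof -
      have "\<xi> * real N \<le> 1 * real N" using \<xi> by (intro mult_right_mono) auto
      then show ?thesis unfolding \<nu>_def by linarith
    qed
    \<comment> \<open>Logarithmic growth puts \<open>k n\<close> below \<open>n\<close>, which gives
      both the admissibility of \<open>\<Upsilon> (k n) (n * N)\<close> and the degree condition
      \<open>k n \<le> 38 * N\<close>.\<close>
    have k_le: "\<forall>\<^sub>F n in sequentially. k n \<le> n"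
    proof -
      have "(\<lambda>n. ln (real n)) \<in> o(\<lambda>n. real n)" by real_asymp
      from landau_o.big_small_trans[OF bigthetaD1[OF kT] this]
      have "(\<lambda>n. real (k n)) \<in> o(\<lambda>n. real n)" .
      from landau_o.smallD[OF this, of 1] show ?thesis by simp
    qed
    have k_ge: "\<forall>\<^sub>F n in sequentially. 4 \<le> k n"
    proof -
      have "filterlim (\<lambda>n. C1 * ln (real n)) at_top sequentially" using assms by real_asymp
      then have "\<forall>\<^sub>F n in sequentially. 4 \<le> C1 * ln (real n)" by (simp add: filterlim_at_top)
      with kC show ?thesis by eventually_elim linarith
    qed
    \<comment> \<open>The conditions on \<open>k\<close> hold for all large arguments and are pulled
      back along \<open>\<nu>\<close>, which tends to infinity.\<close>
    have ev: "\<forall>\<^sub>F N in sequentially. C1 * ln (real (\<nu> N)) \<le> real (k (\<nu> N)) \<and> k (\<nu> N) \<le> \<nu> N \<and> 4 \<le> k (\<nu> N) \<and> 0 < \<nu> N"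
      using eventually_compose_filterlim[OF eventually_conj[OF kC eventually_conj[OF k_le eventually_conj[OF k_ge
        eventually_gt_at_top[of 0]]]] \<nu>_top] .
    have "\<forall>\<^sub>F N in sequentially. 2 \<le> \<xi> * real N"
      using \<xi>(1) by real_asymp
    with ev exD eventually_ge_at_top[of 4]
    have lower: "\<forall>\<^sub>F N in sequentially.
      1 - (8 / (\<xi>\<^sup>2 * real N) + exp (- (5 / 10000) * \<xi> * real N)) \<le> P N"
    proof eventually_elim
      case (elim N)
      define n where "n = \<nu> N"
      have n: "0 < n" "n \<le> N" "\<xi> * real N / 2 \<le> real n"
        using elim \<nu>_lin[of N] \<nu>_le[of N] by (auto simp: n_def)
      obtain r where r: "4 * 2 ^ r \<le> k n"
        "2 * real N * (38 / C) ^ (4 * 2 ^ r) \<le> 8 / (\<xi>\<^sup>2 * real N)"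
        using norm_exponent[OF assms n(1,3) \<xi>(1), of "k n"] elim by (auto simp: n_def C_def)
      have kM: "k n \<le> n * N" "k n \<le> 38 * N" "1 \<le> k n"
      proof -
        have "k n \<le> n" using elim by (simp add: n_def)
        also have "n * 1 \<le> n * N" using elim by (intro mult_le_mono2) auto
        finally show "k n \<le> n * N" by simp
        show "k n \<le> 38 * N" using \<open>k n \<le> n\<close> n(2) by simp
        show "1 \<le> k n" using elim by (simp add: n_def)
      qed
      have "1 - (2 * real N * (38 / C) ^ (4 * 2 ^ r) + exp (- (5 / 10000) * \<xi> * real N)) \<le> P N"
        unfolding P_def n_def[symmetric]
        by (rule kernel_norms_prob[OF \<xi> n _ C c', where d = d and k = "k n" and r = r])
          (use elim d famD[of 4 N] famD[OF kM(3,1)] kM r in auto)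
      then show ?case using r(2) by linarith
    qed
    have "(\<lambda>N. 1 - (8 / (\<xi>\<^sup>2 * real N) + exp (- (5 / 10000) * \<xi> * real N))) \<longlonglongrightarrow> 1"
      using \<xi>(1) by real_asymp
    \<comment> \<open>The upper bound of the sandwich is that probabilities are at most 1.\<close>
    from tendsto_sandwich[OF lower _ this tendsto_const] have "P \<longlonglongrightarrow> 1"
      by (simp add: P_def)
    then show "(\<lambda>N. let n = nat \<lfloor>\<xi> * real N\<rfloor> in
       measure_pmf.prob (pair_pmf (A1_law (\<Upsilon> (k n) (n * N)) n N) (A2_law (G N) n N))
         {(A1, A2). \<forall>x \<in> mat_kernel (A1 \<bullet>\<^sub>H A2).
            c' * \<xi> / sqrt (max 1 (ln (1 / \<xi>))) * sqrt (real N) * lp_norm 2 x \<le> lp_norm 1 x \<and>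
            lp_norm 1 x \<le> sqrt (real N) * lp_norm 2 x}) \<longlonglongrightarrow> 1"
      by (simp add: P_def \<nu>_def Let_def)
  qed
qed

end
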